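(* For each $p$-nilpotent transformation $\phi:V\rightarrow V$, $\mathfrak{L}(\phi)$ is an $\overline{\mathfrak{O}}$-submodule of $\overline{\mathfrak{F}}$ of codimension $n$ transversal to $V$. The correspondence which associates $\mathfrak{L}(\phi)$ to $\phi$ is a bijective correspondence between the set of $p$-nilpotents on $V$ and the set of $\overline{\mathfrak{O}}$-submodules of $\overline{\mathfrak{F}}$ of codimension $n$ transversal to $V$. For a fixed choice of basis of $V$, this correspondence is a $\operatorname{GL}(n,k)$-equivariant algebraic isomorphism from the scheme of $p$-nilpotents to $Y_0$ under the natural action.
   Context: Let $p$ be a prime, $k$ the algebraic closure of $\mathbb{F}_p$, and $V$ a $k$-vector space of dimension $n$. The complete Ore ring $\mathfrak{O}$ is the ring of formal series $\sum_{i\ge0}a_i\theta^i$, $a_i\in k$, with $\theta a=a^p\theta$. Let $\overline{\mathfrak{O}}=\mathfrak{O}/\theta^n\mathfrak{O}$, $\overline\theta$ the class of $\theta$, and $\overline{\mathfrak{F}}=\overline{\mathfrak{O}}\otimes_kV$ (tensor product using the right $k$-structure of $\overline{\mathfrak{O}}$; $k$-vector space and $\overline{\mathfrak{O}}$-module structure by left multiplication; so $\overline{\mathfrak{F}}=\mathfrak{F}/\theta^n\mathfrak{F}$ with $\mathfrak{F}=\mathfrak{O}\otimes_k V\cong\mathfrak{O}^n$, of $k$-dimension $n^2$). $V$ is identified with $1\otimes V\subset\overline{\mathfrak{F}}$. A subspace $\mathfrak{L}$ of codimension $n$ is transversal to $V$ if $\mathfrak{L}\cap V=0$, i.e. $\overline{\mathfrak{F}}=\mathfrak{L}\oplus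 V$. A $p$-linear map $\phi:V\to V$ is an additive map with $\phi(av)=a^p\phi(v)$ for $a\in k$; a $p$-nilpotent transformation is a nilpotent $p$-linear map. With a fixed basis $e_1,\dots,e_n$, vectors are written as rows and $\phi$ has the matrix $B=(b_{i,j})$ with $\phi(e_i)=\sum_jb_{i,j}e_j$, so $\phi(v)=v^{[p]}B$, where for a row or matrix $A$, $A^{[p^j]}$ denotes raising all entries to the $p^j$-th power. The scheme of $p$-nilpotents is the closed subscheme of the space of $n\times n$ matrices defined by $B^{[p^{n-1}]}B^{[p^{n-2}]}\cdots B=0$. $\mathfrak{L}(\phi)$ is the $k$-span of $$R(\phi)=\{\overline\theta^{\,a+b}\otimes\phi^c(m)-\overline\theta^{\,a}\otimes\phi^{b+c}(m):m\in V,\ a,b,c\in\mathbb{Z}_{\ge0}\}.$$ $Y$ is the closed subscheme of the Grassmannian of $(n^2-n)$-dimensional subspaces of $\overline{\mathfrak{F}}$ consisting of those stable under left multiplication by $\overline\theta$, and $Y_0\subset Y$ is the open subscheme of those transversal to $V$. Actions of $\operatorname{GL}(n,k)$ (with respect to the chosen basis): on $p$-linear maps by $\phi\mapsto A\phi A^{-1}$, which on matrices is $B\mapsto A^{[p]}BA^{-1}$; on $\overline{\mathfrak{F}}$ and on its subspaces by right multiplication by $1\otimes A^{-1}$, i.e. $\mathfrak{L}\mapsto\mathfrak{L}A^{-1}$. *)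

theory Defs
  imports "HOL-Analysis.Determinants" "HOL-Library.Poly_Mapping" "HOL-Computational_Algebra.Polynomial"
begin

section \<open>Algebraic closures of finite prime fields\<close>

text \<open>
  The base field is a type of class \<open>alg_closed_field\<close>; over a field of characteristic \<open>p\<close>
  the prime field is the range of \<open>of_nat\<close>.
\<close>

definition is_alg_closure_Fp :: "nat \<Rightarrow> 'k::alg_closed_field itself \<Rightarrow> bool" where
  "is_alg_closure_Fp p (_ :: 'k itself) \<longleftrightarrow> prime p \<and> CHAR('k) = p \<and>
     (\<forall>x::'k. \<exists>q. q \<noteq> 0 \<and> (\<forall>i. poly.coeff q i \<in> range of_nat) \<and> poly q x = 0)"


section \<open>The complete Ore ring and its truncation\<close>

text \<open>
  An element is the family of its left coefficients, that is, \<open>x\<close> stands for the formal series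
  \<open>\<Sum>i. ore_nth x i \<theta>\<^sup>i\<close>.  The product is forced by \<open>a \<theta>\<^sup>i b \<theta>\<^sup>j = a b\<^bsup>p^i\<^esup> \<theta>\<^bsup>i+j\<^esup>\<close>.
\<close>

typedef 'a ore = "UNIV :: (nat \<Rightarrow> 'a) set"
  morphisms ore_nth Abs_ore ..

setup_lifting type_definition_ore

lemma ore_eq_iff: "x = y \<longleftrightarrow> (\<forall>i. ore_nth x i = ore_nth y i)"
  by (metis ext ore_nth_inject)

lemma frob_add: "(x + y) ^ (CHAR('a) ^ i) = x ^ (CHAR('a) ^ i) + y ^ (CHAR('a) ^ i)"
  for x y :: "'a::comm_ring_prime_char"
  by (rule freshmans_dream') auto

lemma frob_sum: "sum f A ^ (CHAR('a) ^ i) = (\<Sum>x\<in>A. f x ^ (CHAR('a) ^ i))"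
  for f :: "'b \<Rightarrow> 'a::comm_ring_prime_char"
  by (rule freshmans_dream_sum') auto

instantiation ore :: (comm_ring_prime_char) ring_1
begin

lift_definition zero_ore :: "'a ore" is "\<lambda>_. 0" .
lift_definition one_ore :: "'a ore" is "\<lambda>i. if i = 0 then 1 else 0" .
lift_definition plus_ore :: "'a ore \<Rightarrow> 'a ore \<Rightarrow> 'a ore" is "\<lambda>x y i. x i + y i" .
lift_definition minus_ore :: "'a ore \<Rightarrow> 'a ore \<Rightarrow> 'a ore" is "\<lambda>x y i. x i - y i" .
lift_definition uminus_ore :: "'a ore \<Rightarrow> 'a ore" is "\<lambda>x i. - x i" .
lift_definition times_ore :: "'a ore \<Rightarrow> 'a ore \<Rightarrow> 'a ore"
  is "\<lambda>x y m. \<Sum>i\<le>m. x i * y (m - i) ^ (CHAR('a) ^ i)" .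

instance
proof
  fix a b c :: "'a ore"
  show "a + b + c = a + (b + c)" "a + b = b + a" "0 + a = a" "- a + a = 0" "a - b = a + - b"
    by (transfer; auto)+
  show "(0::'a ore) \<noteq> 1"
    by transfer (metis zero_neq_one)
  show "1 * a = a"
    by transfer (auto simp: if_distrib if_distribR sum.delta cong: if_cong)
  show "a * 1 = a"
  proof transfer
    fix a :: "nat \<Rightarrow> 'a"
    have "(\<Sum>i\<le>m. a i * (if m - i = 0 then 1 else 0) ^ CHAR('a) ^ i) = a m" for m
    proof -
      have "(\<Sum>i\<le>m. a i * (if m - i = 0 then 1 else 0) ^ CHAR('a) ^ i)
          = (\<Sum>i\<le>m. if i = m then a i else 0)"
        by (intro sum.cong refl) (auto simp: power_0_left)
      then show ?thesis by simp
    qed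
    then show "(\<lambda>m. \<Sum>i\<le>m. a i * (if m - i = 0 then 1 else 0) ^ CHAR('a) ^ i) = a" by blast
  qed
  show "(a + b) * c = a * c + b * c"
    by transfer (auto simp: algebra_simps sum.distrib)
  show "a * (b + c) = a * b + a * c"
    by transfer (auto simp: frob_add algebra_simps sum.distrib)
  show "a * b * c = a * (b * c)"
  proof transfer
    fix a b c :: "nat \<Rightarrow> 'a"
    show "(\<lambda>m. \<Sum>i\<le>m. (\<Sum>j\<le>i. a j * b (i - j) ^ CHAR('a) ^ j) * c (m - i) ^ CHAR('a) ^ i) =
          (\<lambda>m. \<Sum>i\<le>m. a i * (\<Sum>j\<le>m - i. b j * c (m - i - j) ^ CHAR('a) ^ j) ^ CHAR('a) ^ i)"
    proof
      fix m
      let ?f = "\<lambda>i j. a i * b j ^ CHAR('a) ^ i * c (m - (i + j)) ^ CHAR('a) ^ (i + j)"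
      have "(\<Sum>i\<le>m. (\<Sum>j\<le>i. a j * b (i - j) ^ CHAR('a) ^ j) * c (m - i) ^ CHAR('a) ^ i)
          = (\<Sum>i\<le>m. \<Sum>j\<le>i. ?f j (i - j))"
        by (auto simp: sum_distrib_right intro!: sum.cong)
      also have "\<dots> = (\<Sum>(i,j)\<in>{(i,j). i + j \<le> m}. ?f i j)"
        by (rule sum.triangle_reindex_eq [symmetric])
      also have "{(i,j). i + j \<le> m} = (SIGMA i:{..m}. {..m - i})"
        by auto
      also have "(\<Sum>(i,j)\<in>\<dots>. ?f i j) = (\<Sum>i\<le>m. \<Sum>j\<le>m - i. ?f i j)"
        by (subst sum.Sigma) auto
      also have "\<dots> = (\<Sum>i\<le>m. a i * (\<Sum>j\<le>m - i. b j * c (m - i - j) ^ CHAR('a) ^ j) ^ CHAR('a) ^ i)"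
        by (auto simp: frob_sum sum_distrib_left power_mult_distrib power_mult [symmetric]
              power_add ac_simps intro!: sum.cong)
      finally show "(\<Sum>i\<le>m. (\<Sum>j\<le>i. a j * b (i - j) ^ CHAR('a) ^ j) * c (m - i) ^ CHAR('a) ^ i)
          = (\<Sum>i\<le>m. a i * (\<Sum>j\<le>m - i. b j * c (m - i - j) ^ CHAR('a) ^ j) ^ CHAR('a) ^ i)" .
    qed
  qed
qed

end

lift_definition ore_theta :: "'a::comm_ring_prime_char ore" is "\<lambda>i. if i = 1 then 1 else 0" .
lift_definition ore_const :: "'a::comm_ring_prime_char \<Rightarrow> 'a ore" is "\<lambda>a i. if i = 0 then a else 0" .

lemma nth_theta_times:
  "ore_nth (ore_theta * x) m = (if m = 0 then 0 else ore_nth x (m - 1) ^ CHAR('a))"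
  for x :: "'a::comm_ring_prime_char ore"
proof transfer
  fix x :: "nat \<Rightarrow> 'a" and m
  have "(\<Sum>i\<le>m. (if i = 1 then 1 else 0) * x (m - i) ^ CHAR('a) ^ i)
      = (\<Sum>i\<le>m. if i = 1 then x (m - i) ^ CHAR('a) ^ i else 0)"
    by (intro sum.cong) auto
  also have "\<dots> = (if m = 0 then 0 else x (m - 1) ^ CHAR('a))"
    by (auto simp: sum.delta)
  finally show "(\<Sum>i\<le>m. (if i = 1 then 1 else 0) * x (m - i) ^ CHAR('a) ^ i)
      = (if m = 0 then 0 else x (m - 1) ^ CHAR('a))" .
qed

lemma nth_theta_power_times:
  "ore_nth (ore_theta ^ n * x) m = (if m < n then 0 else ore_nth x (m - n) ^ (CHAR('a) ^ n))"
  for x :: "'a::comm_ring_prime_char ore"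
proof (induction n arbitrary: m)
  case (Suc n)
  have "CHAR('a) > 0"
    using CHAR_pos by blast
  with Suc show ?case
    by (auto simp: nth_theta_times mult.assoc power_mult [symmetric] power_0_left mult.commute)
qed auto

lemma theta_power_dvd_iff:
  "(\<exists>z. x = ore_theta ^ n * z) \<longleftrightarrow> (\<forall>i<n. ore_nth x i = 0)"
  for x :: "'a::{alg_closed_field,field_prime_char} ore"
proof
  assume *: "\<forall>i<n. ore_nth x i = 0"
  have "\<exists>y. y ^ (CHAR('a) ^ n) = a" for a :: 'a
    by (rule nth_root_exists) simp
  then obtain r :: "'a \<Rightarrow> 'a" where r: "r a ^ (CHAR('a) ^ n) = a" for a
    by metis
  have "x = ore_theta ^ n * Abs_ore (\<lambda>i. r (ore_nth x (i + n)))"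
    using * by (auto simp: ore_eq_iff nth_theta_power_times Abs_ore_inverse r)
  then show "\<exists>z. x = ore_theta ^ n * z" by blast
qed (auto simp: nth_theta_power_times)

text \<open>
  The truncation is the quotient by the right ideal generated by \<open>\<theta>\<^sup>n\<close>, where \<open>n = CARD('n)\<close>.
  This ideal is two-sided because the Frobenius map of the base field is surjective.
\<close>

definition ore_bar_rel ::
  "'n::finite itself \<Rightarrow> 'a::{alg_closed_field,field_prime_char} ore \<Rightarrow> 'a ore \<Rightarrow> bool" where
  "ore_bar_rel _ x y \<longleftrightarrow> (\<exists>z. x - y = ore_theta ^ CARD('n) * z)"

lemma ore_bar_rel_iff: "ore_bar_rel TYPE('n::finite) x y \<longleftrightarrow> (\<forall>i<CARD('n). ore_nth x i = ore_nth y i)"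
  unfolding ore_bar_rel_def theta_power_dvd_iff by (simp add: minus_ore.rep_eq)

quotient_type (overloaded) ('a, 'n) ore_bar =
  "'a::{alg_closed_field,field_prime_char} ore" / "ore_bar_rel TYPE('n::finite)"
  by (rule equivpI) (auto simp: reflp_def symp_def transp_def ore_bar_rel_iff)

instantiation ore_bar :: ("{alg_closed_field,field_prime_char}", finite) ring_1
begin

lift_definition zero_ore_bar :: "('a, 'b) ore_bar" is 0 .
lift_definition one_ore_bar :: "('a, 'b) ore_bar" is 1 .
lift_definition plus_ore_bar :: "('a, 'b) ore_bar \<Rightarrow> ('a, 'b) ore_bar \<Rightarrow> ('a, 'b) ore_bar"
  is "(+)" by (simp add: ore_bar_rel_iff plus_ore.rep_eq)
lift_definition minus_ore_bar :: "('a, 'b) ore_bar \<Rightarrow> ('a, 'b) ore_bar \<Rightarrow> ('a, 'b) ore_bar"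
  is "(-)" by (simp add: ore_bar_rel_iff minus_ore.rep_eq)
lift_definition uminus_ore_bar :: "('a, 'b) ore_bar \<Rightarrow> ('a, 'b) ore_bar"
  is uminus by (simp add: ore_bar_rel_iff uminus_ore.rep_eq)
lift_definition times_ore_bar :: "('a, 'b) ore_bar \<Rightarrow> ('a, 'b) ore_bar \<Rightarrow> ('a, 'b) ore_bar"
  is "(*)"
  by (auto simp: ore_bar_rel_iff times_ore.rep_eq intro!: sum.cong)

instance
proof
  fix a b c :: "('a, 'b) ore_bar"
  show "a * b * c = a * (b * c)" "a + b + c = a + (b + c)" "a + b = b + a" "0 + a = a"
    "- a + a = 0" "a - b = a + - b" "1 * a = a" "a * 1 = a" "(a + b) * c = a * c + b * c"
    "a * (b + c) = a * b + a * c"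
    by (transfer; simp add: ore_bar_rel_iff algebra_simps)+
  have "CARD('b) > 0" by simp
  then show "(0::('a, 'b) ore_bar) \<noteq> 1"
    by transfer (auto simp: ore_bar_rel_iff zero_ore.rep_eq one_ore.rep_eq)
qed

end

lift_definition obar_theta :: "('a::{alg_closed_field,field_prime_char}, 'n::finite) ore_bar"
  is ore_theta .
lift_definition obar_const ::
  "'a::{alg_closed_field,field_prime_char} \<Rightarrow> ('a, 'n::finite) ore_bar" is ore_const .


section \<open>Tensor products\<close>

text \<open>
  Let a commutative ring act on the right on \<open>'m\<close> (by \<open>ract\<close>) and on the left on \<open>'v\<close> (by
  \<open>lact\<close>).  The tensor product is the free abelian group on \<open>'m \<times> 'v\<close> modulo the subgroup
  \<open>tensor_rels ract lact\<close>.  The predicate \<open>tensor_product ract lact t\<close> says that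
  \<open>t :: 'm \<Rightarrow> 'v \<Rightarrow> 'f\<close> presents the group \<open>'f\<close> as this quotient, with \<open>t x v\<close> the class of
  the generator \<open>(x, v)\<close>; so \<open>t x v\<close> is \<open>x \<otimes> v\<close>.
\<close>

inductive_set tensor_rels ::
  "('m::ab_group_add \<Rightarrow> 'k \<Rightarrow> 'm) \<Rightarrow> ('k \<Rightarrow> 'v::ab_group_add \<Rightarrow> 'v) \<Rightarrow> (('m \<times> 'v) \<Rightarrow>\<^sub>0 int) set"
  for ract :: "'m \<Rightarrow> 'k \<Rightarrow> 'm" and lact :: "'k \<Rightarrow> 'v \<Rightarrow> 'v" where
  zero: "0 \<in> tensor_rels ract lact"
| diff: "u \<in> tensor_rels ract lact \<Longrightarrow> w \<in> tensor_rels ract lact \<Longrightarrow> u - w \<in> tensor_rels ract lact"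
| add_left: "frag_of (x + y, v) - frag_of (x, v) - frag_of (y, v) \<in> tensor_rels ract lact"
| add_right: "frag_of (x, v + w) - frag_of (x, v) - frag_of (x, w) \<in> tensor_rels ract lact"
| balanced: "frag_of (ract x c, v) - frag_of (x, lact c v) \<in> tensor_rels ract lact"

definition tensor_product ::
  "('m::ab_group_add \<Rightarrow> 'k \<Rightarrow> 'm) \<Rightarrow> ('k \<Rightarrow> 'v::ab_group_add \<Rightarrow> 'v) \<Rightarrow> ('m \<Rightarrow> 'v \<Rightarrow> 'f::ab_group_add) \<Rightarrow> bool"
where
  "tensor_product ract lact t \<longleftrightarrow> (\<exists>h :: (('m \<times> 'v) \<Rightarrow>\<^sub>0 int) \<Rightarrow> 'f.
     Modules.additive h \<and> (\<forall>x v. h (frag_of (x, v)) = t x v) \<and> surj h \<and> h -` {0} = tensor_rels ract lact)"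

text \<open>
  The induced map \<open>f \<otimes> g\<close>; it is unique because pure tensors generate, and it exists whenever
  \<open>f\<close> and \<open>g\<close> are additive and compatible with the actions.
\<close>

definition tensor_map ::
  "('m \<Rightarrow> 'v \<Rightarrow> 'f::ab_group_add) \<Rightarrow> ('m' \<Rightarrow> 'v' \<Rightarrow> 'f'::ab_group_add) \<Rightarrow> ('m \<Rightarrow> 'm') \<Rightarrow> ('v \<Rightarrow> 'v') \<Rightarrow> 'f \<Rightarrow> 'f'"
where
  "tensor_map t t' f g = (THE h. Modules.additive h \<and> (\<forall>x v. h (t x v) = t' (f x) (g v)))"


section \<open>The module \<open>\<FF>\<close> and its submodules\<close>

text \<open>
  Throughout, \<open>t x v\<close> is the pure tensor \<open>x \<otimes> v\<close> for \<open>x\<close> in the truncated Ore ring and \<open>v\<close>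
  in the vector space \<open>V\<close>.
\<close>

definition obar_ract ::
  "('k::{alg_closed_field,field_prime_char}, 'n::finite) ore_bar \<Rightarrow> 'k \<Rightarrow> ('k, 'n) ore_bar" where
  "obar_ract x c = x * obar_const c"

definition obar_act ::
  "(('k::{alg_closed_field,field_prime_char}, 'n::finite) ore_bar \<Rightarrow> 'v \<Rightarrow> 'f::ab_group_add)
     \<Rightarrow> ('k, 'n) ore_bar \<Rightarrow> 'f \<Rightarrow> 'f" where
  "obar_act t y = tensor_map t t (\<lambda>x. y * x) (\<lambda>v. v)"

definition fbar_scale ::
  "(('k::{alg_closed_field,field_prime_char}, 'n::finite) ore_bar \<Rightarrow> 'v \<Rightarrow> 'f::ab_group_add)
     \<Rightarrow> 'k \<Rightarrow> 'f \<Rightarrow> 'f" where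
  "fbar_scale t c = obar_act t (obar_const c)"

definition left_submodule :: "('a \<Rightarrow> 'f::ab_group_add \<Rightarrow> 'f) \<Rightarrow> 'f set \<Rightarrow> bool" where
  "left_submodule act L \<longleftrightarrow> 0 \<in> L \<and> (\<forall>x\<in>L. \<forall>y\<in>L. x + y \<in> L) \<and> (\<forall>a. \<forall>x\<in>L. act a x \<in> L)"

definition has_codim :: "('k::field \<Rightarrow> 'f::ab_group_add \<Rightarrow> 'f) \<Rightarrow> 'f set \<Rightarrow> nat \<Rightarrow> bool" where
  "has_codim sc L n \<longleftrightarrow> module.subspace sc L \<and>
     vector_space.dim sc L + n = vector_space.dim sc UNIV"

definition transversal_V ::
  "(('k::{alg_closed_field,field_prime_char}, 'n::finite) ore_bar \<Rightarrow> 'v \<Rightarrow> 'f::ab_group_add)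
     \<Rightarrow> 'f set \<Rightarrow> bool" where
  "transversal_V t L \<longleftrightarrow> L \<inter> range (t 1) = {0}"


section \<open>\<open>p\<close>-nilpotents\<close>

definition p_linear ::
  "nat \<Rightarrow> ('k::field \<Rightarrow> 'v::ab_group_add \<Rightarrow> 'v) \<Rightarrow> ('v \<Rightarrow> 'v) \<Rightarrow> bool" where
  "p_linear p sc \<phi> \<longleftrightarrow> Modules.additive \<phi> \<and> (\<forall>a v. \<phi> (sc a v) = sc (a ^ p) (\<phi> v))"

definition p_nilpotent ::
  "nat \<Rightarrow> ('k::field \<Rightarrow> 'v::ab_group_add \<Rightarrow> 'v) \<Rightarrow> ('v \<Rightarrow> 'v) \<Rightarrow> bool" where
  "p_nilpotent p sc \<phi> \<longleftrightarrow> p_linear p sc \<phi> \<and> (\<exists>m. \<forall>v. (\<phi> ^^ m) v = 0)"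

definition L_of ::
  "(('k::{alg_closed_field,field_prime_char}, 'n::finite) ore_bar \<Rightarrow> 'v \<Rightarrow> 'f::ab_group_add)
     \<Rightarrow> ('v \<Rightarrow> 'v) \<Rightarrow> 'f set" where
  "L_of t \<phi> = module.span (fbar_scale t)
     {t (obar_theta ^ (a + b)) ((\<phi> ^^ c) m) - t (obar_theta ^ a) ((\<phi> ^^ (b + c)) m) | m a b c. True}"


section \<open>Bases and matrices\<close>

definition is_basis :: "('k::field \<Rightarrow> 'v::ab_group_add \<Rightarrow> 'v) \<Rightarrow> ('n::finite \<Rightarrow> 'v) \<Rightarrow> bool" where
  "is_basis sc e \<longleftrightarrow> inj e \<and> \<not> module.dependent sc (range e) \<and> module.span sc (range e) = UNIV"

text \<open>Vectors are rows: the \<open>i\<close>-th row of the matrix holds the coordinates of the image of \<open>e i\<close>.\<close>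

definition has_matrix ::
  "('k::field \<Rightarrow> 'v::ab_group_add \<Rightarrow> 'v) \<Rightarrow> ('n::finite \<Rightarrow> 'v) \<Rightarrow> ('v \<Rightarrow> 'v) \<Rightarrow> 'k^'n^'n \<Rightarrow> bool" where
  "has_matrix sc e \<phi> B \<longleftrightarrow> (\<forall>i. \<phi> (e i) = (\<Sum>j\<in>UNIV. sc (B $ i $ j) (e j)))"

text \<open>The linear map \<open>v \<mapsto> vC\<close> of \<open>V\<close>.\<close>

definition mat_right ::
  "('k::field \<Rightarrow> 'v::ab_group_add \<Rightarrow> 'v) \<Rightarrow> ('n::finite \<Rightarrow> 'v) \<Rightarrow> 'k^'n^'n \<Rightarrow> 'v \<Rightarrow> 'v" where
  "mat_right sc e C = (THE g. Vector_Spaces.linear sc sc g \<and> has_matrix sc e g C)"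

text \<open>Right multiplication by \<open>1 \<otimes> C\<close>.\<close>

definition fbar_mat_right ::
  "(('k::{alg_closed_field,field_prime_char}, 'n::finite) ore_bar \<Rightarrow> 'v::ab_group_add \<Rightarrow> 'f::ab_group_add)
     \<Rightarrow> ('k \<Rightarrow> 'v \<Rightarrow> 'v) \<Rightarrow> ('n \<Rightarrow> 'v) \<Rightarrow> 'k^'n^'n \<Rightarrow> 'f \<Rightarrow> 'f" where
  "fbar_mat_right t sc e C = tensor_map t t (\<lambda>x. x) (mat_right sc e C)"

definition frob_mat :: "nat \<Rightarrow> 'r::comm_ring_1^'n^'m \<Rightarrow> 'r^'n^'m" where
  "frob_mat q B = map_matrix (\<lambda>x. x ^ q) B"


section \<open>Points of the schemes with values in \<open>k\<close>-algebras\<close>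

text \<open>
  A scheme over \<open>k\<close> is given by its functor of points on commutative \<open>k\<close>-algebras, and a morphism
  by a natural transformation.  An algebra is a type \<open>'r\<close> of class \<open>comm_ring_1\<close> with a
  ring homomorphism \<open>\<eta> :: 'k \<Rightarrow> 'r\<close>.  (The zero ring has no such type; its points are
  irrelevant, since every scheme has exactly one point with values in it.)
\<close>

definition is_ring_hom :: "('a::comm_ring_1 \<Rightarrow> 'b::comm_ring_1) \<Rightarrow> bool" where
  "is_ring_hom f \<longleftrightarrow> f 1 = 1 \<and> (\<forall>x y. f (x + y) = f x + f y) \<and> (\<forall>x y. f (x * y) = f x * f y)"

text \<open>\<open>frob_prod p B n\<close> is \<open>B\<^bsup>[p^(n-1)]\<^esup> \<cdots> B\<^bsup>[p]\<^esup> B\<close>.\<close>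

primrec frob_prod :: "nat \<Rightarrow> 'r::comm_ring_1^'n^'n \<Rightarrow> nat \<Rightarrow> 'r^'n^'n" where
  "frob_prod p B 0 = mat 1"
| "frob_prod p B (Suc j) = frob_mat (p ^ j) B ** frob_prod p B j"

definition nilp_points :: "nat \<Rightarrow> ('r::comm_ring_1^'n::finite^'n) set" where
  "nilp_points p = {B. frob_prod p B CARD('n) = 0}"

text \<open>
  \<open>base_change t \<eta> tR\<close>: the map \<open>tR\<close> presents \<open>'fr\<close> as the base change of \<open>'f\<close> (with its left
  \<open>k\<close>-structure) to the \<open>k\<close>-algebra \<open>'r\<close>.
\<close>

definition base_change ::
  "(('k::{alg_closed_field,field_prime_char}, 'n::finite) ore_bar \<Rightarrow> 'v \<Rightarrow> 'f::ab_group_add)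
     \<Rightarrow> ('k \<Rightarrow> 'r::comm_ring_1) \<Rightarrow> ('f \<Rightarrow> 'r \<Rightarrow> 'fr::ab_group_add) \<Rightarrow> bool" where
  "base_change t \<eta> tR \<longleftrightarrow> is_ring_hom \<eta> \<and>
     tensor_product (\<lambda>x c. fbar_scale t c x) (\<lambda>c r. \<eta> c * r) tR"

definition bc_scale :: "('f \<Rightarrow> 'r::comm_ring_1 \<Rightarrow> 'fr::ab_group_add) \<Rightarrow> 'r \<Rightarrow> 'fr \<Rightarrow> 'fr" where
  "bc_scale tR r = tensor_map tR tR (\<lambda>x. x) (\<lambda>s. r * s)"

text \<open>
  Left multiplication by \<open>\<theta>\<close> is \<open>p\<close>-linear for the left \<open>k\<close>-structure, so its base change is
  \<open>x \<otimes> r \<mapsto> \<theta>x \<otimes> r\<^sup>p\<close>.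
\<close>

definition bc_theta ::
  "nat \<Rightarrow> (('k::{alg_closed_field,field_prime_char}, 'n::finite) ore_bar \<Rightarrow> 'v \<Rightarrow> 'f::ab_group_add)
     \<Rightarrow> ('f \<Rightarrow> 'r::comm_ring_1 \<Rightarrow> 'fr::ab_group_add) \<Rightarrow> 'fr \<Rightarrow> 'fr" where
  "bc_theta p t tR = tensor_map tR tR (obar_act t obar_theta) (\<lambda>r. r ^ p)"

definition bc_V ::
  "(('k::{alg_closed_field,field_prime_char}, 'n::finite) ore_bar \<Rightarrow> 'v \<Rightarrow> 'f::ab_group_add)
     \<Rightarrow> ('f \<Rightarrow> 'r::comm_ring_1 \<Rightarrow> 'fr::ab_group_add) \<Rightarrow> 'fr set" where
  "bc_V t tR = module.span (bc_scale tR) (range (\<lambda>v. tR (t 1 v) 1))"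

text \<open>
  The quotient by \<open>L\<close> is locally free of rank \<open>d\<close>: the spectrum is covered by basic open
  sets \<open>D(f)\<close> such that the quotient becomes free with \<open>d\<close> basis elements after inverting
  \<open>f\<close>.  Denominators of a basis may be cleared, so the \<open>b i\<close> can be taken before localizing.
\<close>

definition locally_free_quotient ::
  "('r::comm_ring_1 \<Rightarrow> 'fr::ab_group_add \<Rightarrow> 'fr) \<Rightarrow> 'fr set \<Rightarrow> nat \<Rightarrow> bool" where
  "locally_free_quotient sc L d \<longleftrightarrow>
     (\<exists>S. finite S \<and> (\<exists>g. (\<Sum>f\<in>S. g f * f) = 1) \<and>
       (\<forall>f\<in>S. \<exists>b :: nat \<Rightarrow> 'fr.
          (\<forall>x. \<exists>N c. sc (f ^ N) x - (\<Sum>i<d. sc (c i) (b i)) \<in> L) \<and>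
          (\<forall>c. (\<Sum>i<d. sc (c i) (b i)) \<in> L \<longrightarrow> (\<forall>i<d. \<exists>N. f ^ N * c i = 0))))"

text \<open>
  The Grassmannian of subspaces of codimension \<open>n = CARD('n)\<close> (dimension \<open>n\<^sup>2 - n\<close>), the
  closed subscheme \<open>Y\<close> of the \<open>\<theta>\<close>-stable ones, and its open subscheme \<open>Y\<^sub>0\<close>.  A family lies
  in \<open>Y\<^sub>0\<close> if each of its fibres is transversal to \<open>V\<close>; by Nakayama's lemma this is the
  decomposition into a direct sum below.
\<close>

definition grass_points ::
  "(('k::{alg_closed_field,field_prime_char}, 'n::finite) ore_bar \<Rightarrow> 'v \<Rightarrow> 'f::ab_group_add)
     \<Rightarrow> ('f \<Rightarrow> 'r::comm_ring_1 \<Rightarrow> 'fr::ab_group_add) \<Rightarrow> 'fr set set" where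
  "grass_points t tR =
     {L. module.subspace (bc_scale tR) L \<and> locally_free_quotient (bc_scale tR) L CARD('n)}"

definition Y_points ::
  "nat \<Rightarrow> (('k::{alg_closed_field,field_prime_char}, 'n::finite) ore_bar \<Rightarrow> 'v \<Rightarrow> 'f::ab_group_add)
     \<Rightarrow> ('f \<Rightarrow> 'r::comm_ring_1 \<Rightarrow> 'fr::ab_group_add) \<Rightarrow> 'fr set set" where
  "Y_points p t tR = {L \<in> grass_points t tR. bc_theta p t tR ` L \<subseteq> L}"

definition Y0_points ::
  "nat \<Rightarrow> (('k::{alg_closed_field,field_prime_char}, 'n::finite) ore_bar \<Rightarrow> 'v \<Rightarrow> 'f::ab_group_add)
     \<Rightarrow> ('f \<Rightarrow> 'r::comm_ring_1 \<Rightarrow> 'fr::ab_group_add) \<Rightarrow> 'fr set set" where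
  "Y0_points p t tR = {L \<in> Y_points p t tR.
     L \<inter> bc_V t tR = {0} \<and> (\<forall>x. \<exists>y\<in>L. \<exists>v\<in>bc_V t tR. x = y + v)}"

text \<open>
  Over an algebra \<open>'r\<close> a matrix \<open>B\<close> gives the map \<open>m \<mapsto> m\<^bsup>[p]\<^esup> B\<close> on rows, and a row \<open>m\<close> is the
  element \<open>\<Sum>j. (1 \<otimes> e j) \<otimes> m\<^sub>j\<close> of the base change of \<open>V\<close>.  Since \<open>\<theta>\<^sup>a \<otimes> m = \<theta>\<^sup>a (1 \<otimes> m)\<close>,
  the defining generators of \<open>L_of\<close> make sense over every \<open>'r\<close>.
\<close>

definition row_map :: "nat \<Rightarrow> 'r::comm_ring_1^'n::finite^'n \<Rightarrow> 'r^'n \<Rightarrow> 'r^'n" where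
  "row_map p B m = (\<chi> i. m $ i ^ p) v* B"

definition row_vec ::
  "(('k::{alg_closed_field,field_prime_char}, 'n::finite) ore_bar \<Rightarrow> 'v \<Rightarrow> 'f::ab_group_add)
     \<Rightarrow> ('f \<Rightarrow> 'r::comm_ring_1 \<Rightarrow> 'fr::ab_group_add) \<Rightarrow> ('n \<Rightarrow> 'v) \<Rightarrow> 'r^'n \<Rightarrow> 'fr" where
  "row_vec t tR e m = (\<Sum>j\<in>UNIV. tR (t 1 (e j)) (m $ j))"

definition L_points ::
  "nat \<Rightarrow> (('k::{alg_closed_field,field_prime_char}, 'n::finite) ore_bar \<Rightarrow> 'v \<Rightarrow> 'f::ab_group_add)
     \<Rightarrow> ('f \<Rightarrow> 'r::comm_ring_1 \<Rightarrow> 'fr::ab_group_add) \<Rightarrow> ('n \<Rightarrow> 'v) \<Rightarrow> 'r^'n^'n \<Rightarrow> 'fr set" where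
  "L_points p t tR e B = module.span (bc_scale tR)
     {(bc_theta p t tR ^^ (a + b)) (row_vec t tR e ((row_map p B ^^ c) m))
      - (bc_theta p t tR ^^ a) (row_vec t tR e ((row_map p B ^^ (b + c)) m)) | m a b c. True}"

text \<open>Functoriality: pullback of a subbundle along an algebra homomorphism \<open>f\<close>.\<close>

definition pullback_sub ::
  "('f \<Rightarrow> 'r::comm_ring_1 \<Rightarrow> 'fr::ab_group_add) \<Rightarrow> ('f \<Rightarrow> 's::comm_ring_1 \<Rightarrow> 'fs::ab_group_add)
     \<Rightarrow> ('r \<Rightarrow> 's) \<Rightarrow> 'fr set \<Rightarrow> 'fs set" where
  "pullback_sub tR tS f L = module.span (bc_scale tS) (tensor_map tR tS (\<lambda>x. x) f ` L)"

text \<open>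
  The action of \<open>A \<in> GL(n,k)\<close>: \<open>B \<mapsto> A\<^bsup>[p]\<^esup> B A\<^bsup>-1\<^esup>\<close> on matrices over an algebra, and
  \<open>L \<mapsto> L A\<^bsup>-1\<^esup>\<close> on submodules, through the base change of right multiplication by
  \<open>1 \<otimes> A\<^bsup>-1\<^esup>\<close>.
\<close>

definition gl_act_mat ::
  "nat \<Rightarrow> ('k::field \<Rightarrow> 'r::comm_ring_1) \<Rightarrow> 'k^'n::finite^'n \<Rightarrow> 'r^'n^'n \<Rightarrow> 'r^'n^'n" where
  "gl_act_mat p \<eta> A B = map_matrix \<eta> (frob_mat p A) ** B ** map_matrix \<eta> (matrix_inv A)"

definition gl_act_sub ::
  "(('k::{alg_closed_field,field_prime_char}, 'n::finite) ore_bar \<Rightarrow> 'v::ab_group_add \<Rightarrow> 'f::ab_group_add)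
     \<Rightarrow> ('k \<Rightarrow> 'v \<Rightarrow> 'v) \<Rightarrow> ('n \<Rightarrow> 'v) \<Rightarrow> ('f \<Rightarrow> 'r::comm_ring_1 \<Rightarrow> 'fr::ab_group_add)
     \<Rightarrow> 'k^'n^'n \<Rightarrow> 'fr set \<Rightarrow> 'fr set" where
  "gl_act_sub t sc e tR A L =
     tensor_map tR tR (fbar_mat_right t sc e (matrix_inv A)) (\<lambda>r. r) ` L"

end

theory Submission
  imports Defs
begin

text \<open>
  Let \<open>R\<close> be a \<open>k\<close>-algebra.  Over \<open>R\<close> the module \<open>\<FF>\<close> is free: every element is uniquely
  \<open>\<Sum>a<n. \<theta>\<^sup>a \<otimes> x\<^sub>a\<close> with rows \<open>x\<^sub>a\<close> over \<open>R\<close>, its levels.  Left multiplication by \<open>\<theta>\<close> raises the level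
  by one, applies the Frobenius map to the entries, and kills the last level.

  Let \<open>\<phi>(m) = m\<^bsup>[p]\<^esup> B\<close> and \<open>P\<^sub>a = B\<^bsup>[p^(a-1)]\<^esup> \<cdots> B\<close>, so that \<open>\<phi>\<^sup>a(m) = m\<^bsup>[p^a]\<^esup> P\<^sub>a\<close>.  If
  \<open>P\<^sub>n = 0\<close>, then the \<open>R\<close>-linear map \<open>proj B : x \<mapsto> \<Sum>a<n. x\<^sub>a P\<^sub>a\<close> is a retraction of the module onto
  \<open>V\<close> that carries \<open>\<theta>\<close> to \<open>\<phi>\<close>; it sends \<open>\<theta>\<^sup>a \<otimes> m\<close> to \<open>\<phi>\<^sup>a(m)\<close> for every \<open>a\<close>, because both sides vanish
  for \<open>a \<ge> n\<close>.  Hence it kills the generators of \<open>\<LL>(\<phi>)\<close>, while \<open>x - proj B x\<close> is a combination of the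
  generators \<open>\<theta>\<^sup>a \<otimes> m - 1 \<otimes> \<phi>\<^sup>a(m)\<close>.  So \<open>\<LL>(\<phi>)\<close> is the kernel of \<open>proj B\<close>
  (\<open>relation_span_eq_kernel\<close>): it is \<open>\<theta>\<close>-stable and complementary to \<open>V\<close>.

  Conversely, let \<open>L\<close> be a \<open>\<theta>\<close>-stable complement of \<open>V\<close> and \<open>\<pi>\<close> the projection onto \<open>V\<close> along \<open>L\<close>.
  Stability gives \<open>\<pi>(\<theta> x) = \<pi>(\<theta> \<pi>(x))\<close>, so that \<open>\<pi>\<close> carries \<open>\<theta>\<close> to \<open>\<phi>(m) = \<pi>(\<theta> \<otimes> m)\<close>.  Since
  \<open>\<theta>\<^sup>n = 0\<close>, the matrix of \<open>\<phi>\<close> is a point of the scheme of nilpotents; the maps \<open>\<pi>\<close> and \<open>proj B\<close> agree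
  on all \<open>\<theta>\<^sup>a \<otimes> m\<close> and hence everywhere, and \<open>L = \<LL>(\<phi>)\<close> (\<open>complement_is_relation_span\<close>).  The
  matrix is recovered from \<open>L\<close> because \<open>\<theta> \<otimes> e\<^sub>j\<close> is congruent to the \<open>j\<close>-th row of \<open>B\<close> modulo \<open>L\<close>.

  This argument is carried out once, over any \<open>R\<close> of characteristic \<open>p\<close>, in the locale
  \<open>theta_module\<close>.  The tensor products of the theorem are instances of that locale by their universal
  property, which supplies the level coordinates.  The statement over \<open>k\<close> itself is the case
  \<open>R = k\<close>, since \<open>M \<otimes>\<^sub>k k = M\<close> (\<open>base_change_self\<close>).  It needs two facts of linear algebra over
  \<open>k\<close>: a subspace that meets \<open>V\<close> in \<open>0\<close> has codimension \<open>n\<close> if and only if it is a complement of \<open>V\<close>,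
  and a nilpotent \<open>p\<close>-linear map on \<open>V\<close> satisfies \<open>\<phi>\<^sup>n = 0\<close>, because the kernels of its
  iterates are subspaces that grow strictly until they exhaust \<open>V\<close>.

  Naturality in \<open>R\<close> and equivariance both come from comparing kernels: a homomorphism \<open>f : R \<rightarrow> S\<close>
  intertwines \<open>proj B\<close> with \<open>proj (f B)\<close>, and right multiplication by \<open>A\<^bsup>-1\<^esup>\<close> intertwines it
  with \<open>proj (A\<^bsup>[p]\<^esup> B A\<^bsup>-1\<^esup>)\<close>.
\<close>

section \<open>Tensor products\<close>

text \<open>One of the two sums is always empty.\<close>

definition int_mult :: "int \<Rightarrow> 'a::ab_group_add \<Rightarrow> 'a" where
  "int_mult n x = (\<Sum>i<nat n. x) - (\<Sum>i<nat (- n). x)"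

lemma int_mult_1 [simp]: "int_mult 1 x = x" and int_mult_0 [simp]: "int_mult 0 x = 0"
  by (simp_all add: int_mult_def)

lemma int_mult_add: "int_mult (m + n) x = int_mult m x + int_mult n x"
proof -
  have rep: "(\<Sum>i<a + b. x) = (\<Sum>i<a. x) + (\<Sum>i<b. x)" for a b :: nat
    by (induction b) (simp_all add: add.assoc)
  have "nat (m + n) + (nat (- m) + nat (- n)) = nat m + nat n + nat (- (m + n))"
    by linarith
  then have "(\<Sum>i<nat (m + n) + (nat (- m) + nat (- n)). x) = (\<Sum>i<nat m + nat n + nat (- (m + n)). x)"
    by metis
  then show ?thesis
    unfolding rep int_mult_def by (simp add: algebra_simps)
qed

text \<open>The homomorphism on the free abelian group with prescribed values on the generators.\<close>

definition frag_sum :: "('a \<Rightarrow> 'b::ab_group_add) \<Rightarrow> ('a \<Rightarrow>\<^sub>0 int) \<Rightarrow> 'b" where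
  "frag_sum \<beta> u = (\<Sum>x\<in>Poly_Mapping.keys u. int_mult (Poly_Mapping.lookup u x) (\<beta> x))"

lemma frag_sum_of [simp]: "frag_sum \<beta> (frag_of x) = \<beta> x"
  by (simp add: frag_sum_def)

lemma frag_sum_superset:
  assumes "finite A" "Poly_Mapping.keys u \<subseteq> A"
  shows "frag_sum \<beta> u = (\<Sum>x\<in>A. int_mult (Poly_Mapping.lookup u x) (\<beta> x))"
  unfolding frag_sum_def using assms
  by (intro sum.mono_neutral_left) (auto simp: in_keys_iff)

lemma additive_frag_sum:
  fixes \<beta> :: "'a \<Rightarrow> 'b::ab_group_add"
  shows "Modules.additive (frag_sum \<beta>)"
proof
  fix u w :: "'a \<Rightarrow>\<^sub>0 int"
  let ?A = "Poly_Mapping.keys u \<union> Poly_Mapping.keys w"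
  have "frag_sum \<beta> v = (\<Sum>x\<in>?A. int_mult (Poly_Mapping.lookup v x) (\<beta> x))"
    if "v \<in> {u, w, u + w}" for v
    using that Poly_Mapping.keys_add[of u w] by (intro frag_sum_superset) auto
  then show "frag_sum \<beta> (u + w) = frag_sum \<beta> u + frag_sum \<beta> w"
    by (simp add: lookup_add int_mult_add sum.distrib)
qed

text \<open>Subtraction alone suffices: it yields \<open>0\<close>, negatives and sums.\<close>

lemma frag_induct [case_names of diff]:
  assumes "\<And>x. P (frag_of x)" "\<And>u w. P u \<Longrightarrow> P w \<Longrightarrow> P (u - w)"
  shows "P u"
proof -
  have "P 0"
    using assms(2)[OF assms(1) assms(1), of undefined undefined] by simp
  then show ?thesis
    by (rule frag_induction[OF subset_UNIV]) (simp_all add: assms)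
qed

locale tensor =
  fixes ract :: "'m::ab_group_add \<Rightarrow> 'k \<Rightarrow> 'm" and lact :: "'k \<Rightarrow> 'v::ab_group_add \<Rightarrow> 'v"
    and t :: "'m \<Rightarrow> 'v \<Rightarrow> 'f::ab_group_add"
  assumes tensor: "tensor_product ract lact t"
begin

lemma presentation:
  obtains h where "Modules.additive h" "\<And>x v. h (frag_of (x, v)) = t x v" "surj h"
    "h -` {0} = tensor_rels ract lact"
  using tensor unfolding tensor_product_def by blast

lemma add_left: "t (x + y) v = t x v + t y v"
  and add_right: "t x (v + w) = t x v + t x w"
  and balanced: "t (ract x c) v = t x (lact c v)"
proof -
  obtain h where h: "Modules.additive h" "\<And>x v. h (frag_of (x, v)) = t x v"
    "h -` {0} = tensor_rels ract lact"
    using presentation by metis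
  interpret h: Modules.additive h by fact
  have rel: "h u = 0" if "u \<in> tensor_rels ract lact" for u
    using that h(3) by auto
  show "t (x + y) v = t x v + t y v"
    using rel[OF tensor_rels.add_left, of x y v] by (simp add: h.diff h(2) diff_eq_eq add.commute)
  show "t x (v + w) = t x v + t x w"
    using rel[OF tensor_rels.add_right, of x v w] by (simp add: h.diff h(2) diff_eq_eq add.commute)
  show "t (ract x c) v = t x (lact c v)"
    using rel[OF tensor_rels.balanced, of x c v] by (simp add: h.diff h(2))
qed

sublocale left: Modules.additive "\<lambda>x. t x v" for v
  by standard (rule add_left)

sublocale right: Modules.additive "t x" for x
  by standard (rule add_right)

text \<open>The presentation is surjective, so pure tensors generate under subtraction.\<close>

lemma induct [case_names pure diff]:
  assumes "\<And>x v. P (t x v)" "\<And>f g. P f \<Longrightarrow> P g \<Longrightarrow> P (f - g)"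
  shows "P f"
proof -
  obtain h where h: "Modules.additive h" "\<And>x v. h (frag_of (x, v)) = t x v" "surj h"
    using presentation by metis
  interpret h: Modules.additive h by fact
  have "P (h u)" for u
    by (induction u rule: frag_induct) (auto simp: h.diff h(2) assms)
  then show ?thesis
    using h(3) by (metis surjD)
qed

lemma additive_eqI:
  assumes "Modules.additive g" "Modules.additive h" "\<And>x v. g (t x v) = h (t x v)"
  shows "g = h"
proof
  interpret g: Modules.additive g by fact
  interpret h: Modules.additive h by fact
  show "g f = h f" for f
    by (induction f rule: induct) (simp_all add: assms(3) g.diff h.diff)
qed

text \<open>
  The homomorphism \<open>\<beta>\<close> induces on the free abelian group vanishes on \<open>tensor_rels\<close>, that is, on the
  kernel of the presentation, so it factors through the presentation.
\<close>

lemma universal: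
  fixes \<beta> :: "'m \<Rightarrow> 'v \<Rightarrow> 'g::ab_group_add"
  assumes "\<And>x y v. \<beta> (x + y) v = \<beta> x v + \<beta> y v" "\<And>x v w. \<beta> x (v + w) = \<beta> x v + \<beta> x w"
    and "\<And>x c v. \<beta> (ract x c) v = \<beta> x (lact c v)"
  obtains g where "Modules.additive g" "\<And>x v. g (t x v) = \<beta> x v"
proof -
  obtain h where h: "Modules.additive h" "\<And>x v. h (frag_of (x, v)) = t x v" "surj h"
    "h -` {0} = tensor_rels ract lact"
    using presentation by metis
  interpret h: Modules.additive h by fact
  let ?s = "frag_sum (\<lambda>(x, v). \<beta> x v)"
  interpret s: Modules.additive ?s by (rule additive_frag_sum)
  have s0: "?s u = 0" if "u \<in> tensor_rels ract lact" for u
    using that by induction (simp_all add: s.zero s.diff assms)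
  have s_eq: "?s u = ?s w" if "h u = h w" for u w
  proof -
    have "h (u - w) = 0" using that by (simp add: h.diff)
    then have "?s (u - w) = 0" using h(4) by (intro s0) auto
    then show ?thesis by (simp add: s.diff)
  qed
  define g where "g f = ?s (inv h f)" for f
  have hi: "h (inv h f) = f" for f
    using h(3) by (simp add: surj_f_inv_f)
  have "Modules.additive g"
  proof
    fix f f'
    have "?s (inv h (f + f')) = ?s (inv h f + inv h f')"
      by (rule s_eq) (simp add: hi h.add)
    then show "g (f + f') = g f + g f'"
      by (simp add: g_def s.add)
  qed
  moreover have "g (t x v) = \<beta> x v" for x v
  proof -
    have "?s (inv h (t x v)) = ?s (frag_of (x, v))"
      by (rule s_eq) (simp add: hi h(2))
    then show ?thesis by (simp add: g_def)
  qed
  ultimately show ?thesis by (rule that)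
qed

text \<open>
  The existence that the definite description in \<open>tensor_map\<close> relies on; after this lemma it may be
  used through its values on pure tensors only.
\<close>

lemma tensor_map:
  fixes t' :: "'m' \<Rightarrow> 'v' \<Rightarrow> 'g::ab_group_add"
  assumes "\<And>x y v. t' (f (x + y)) (g v) = t' (f x) (g v) + t' (f y) (g v)"
    and "\<And>x v w. t' (f x) (g (v + w)) = t' (f x) (g v) + t' (f x) (g w)"
    and "\<And>x c v. t' (f (ract x c)) (g v) = t' (f x) (g (lact c v))"
  shows "Modules.additive (tensor_map t t' f g)"
    and "tensor_map t t' f g (t x v) = t' (f x) (g v)"
proof -
  obtain h where h: "Modules.additive h" "\<And>x v. h (t x v) = t' (f x) (g v)"
    using universal[of "\<lambda>x v. t' (f x) (g v)"] assms by blast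
  have "tensor_map t t' f g = h"
    unfolding tensor_map_def
    using h by (intro the_equality conjI allI additive_eqI[OF _ h(1)]) auto
  then show "Modules.additive (tensor_map t t' f g)"
    "tensor_map t t' f g (t x v) = t' (f x) (g v)"
    using h by auto
qed

lemma tensor_map_bilinear:
  fixes \<beta> :: "'m \<Rightarrow> 'v \<Rightarrow> 'g::ab_group_add"
  assumes "\<And>x y v. \<beta> (x + y) v = \<beta> x v + \<beta> y v" "\<And>x v w. \<beta> x (v + w) = \<beta> x v + \<beta> x w"
    and "\<And>x c v. \<beta> (ract x c) v = \<beta> x (lact c v)"
  shows "Modules.additive (tensor_map t \<beta> (\<lambda>x. x) (\<lambda>v. v))"
    and "tensor_map t \<beta> (\<lambda>x. x) (\<lambda>v. v) (t x v) = \<beta> x v"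
  using tensor_map[of \<beta> "\<lambda>x. x" "\<lambda>v. v"] assms by auto

end


section \<open>Coefficients in the truncated Ore ring\<close>

text \<open>
  The left coefficients.  They are cut off at \<open>n\<close>, where representatives of the same class may differ.
\<close>

lift_definition obar_nth :: "('k::{alg_closed_field,field_prime_char}, 'n::finite) ore_bar \<Rightarrow> nat \<Rightarrow> 'k"
  is "\<lambda>x a. if a < CARD('n) then ore_nth x a else 0"
  by (auto simp: ore_bar_rel_iff)

context
  fixes x y :: "('k::{alg_closed_field,field_prime_char}, 'n::finite) ore_bar"
begin

lemma obar_eqI: "x = y" if "\<And>a. a < CARD('n) \<Longrightarrow> obar_nth x a = obar_nth y a"
  using that by transfer (simp add: ore_bar_rel_iff)

lemma obar_nth_beyond [simp]: "CARD('n) \<le> a \<Longrightarrow> obar_nth x a = 0"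
  by transfer simp

lemma obar_nth_add [simp]: "obar_nth (x + y) a = obar_nth x a + obar_nth y a"
  by transfer (simp add: plus_ore.rep_eq)

lemma obar_nth_const_times [simp]: "obar_nth (obar_const c * x) a = c * obar_nth x a"
proof transfer
  fix c :: 'k and x :: "'k ore" and a
  have "(\<Sum>i\<le>a. (if i = 0 then c else 0) * ore_nth x (a - i) ^ CHAR('k) ^ i)
      = (\<Sum>i\<le>a. if i = 0 then c * ore_nth x a else 0)"
    by (intro sum.cong) auto
  then show "(if a < CARD('n) then ore_nth (ore_const c * x) a else 0)
      = c * (if a < CARD('n) then ore_nth x a else 0)"
    by (simp add: times_ore.rep_eq ore_const.rep_eq sum.delta)
qed

lemma obar_nth_times_const [simp]: "obar_nth (x * obar_const c) a = obar_nth x a * c ^ (CHAR('k) ^ a)"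
proof transfer
  fix c :: 'k and x :: "'k ore" and a
  have "(\<Sum>i\<le>a. ore_nth x i * (if a - i = 0 then c else 0) ^ CHAR('k) ^ i)
      = (\<Sum>i\<le>a. if i = a then ore_nth x a * c ^ CHAR('k) ^ a else 0)"
    by (intro sum.cong) (auto simp: power_0_left)
  then show "(if a < CARD('n) then ore_nth (x * ore_const c) a else 0)
      = (if a < CARD('n) then ore_nth x a else 0) * c ^ CHAR('k) ^ a"
    by (simp add: times_ore.rep_eq ore_const.rep_eq sum.delta)
qed

lemma obar_nth_theta_times:
  "obar_nth (obar_theta * x) a
     = (if a = 0 \<or> CARD('n) \<le> a then 0 else obar_nth x (a - 1) ^ CHAR('k))"
  by transfer (auto simp: nth_theta_times)

end

lemma obar_nth_theta_power_times:
  "obar_nth (obar_theta ^ b * x) a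
     = (if b \<le> a \<and> a < CARD('n) then obar_nth x (a - b) ^ (CHAR('k) ^ b) else 0)"
  for x :: "('k::{alg_closed_field,field_prime_char}, 'n::finite) ore_bar"
proof (induction b arbitrary: a)
  case 0
  show ?case by simp
next
  case (Suc b)
  have "CHAR('k) > 0" by simp
  moreover have "a - 1 - b = a - Suc b" by simp
  ultimately show ?case
    using Suc[of "a - 1"]
    by (auto simp: obar_nth_theta_times mult.assoc power_mult[symmetric] mult.commute)
qed

lemma obar_nth_1 [simp]: "obar_nth (1 :: ('k::{alg_closed_field,field_prime_char}, 'n::finite) ore_bar) a
    = (if a = 0 then 1 else 0)"
  by transfer (auto simp: one_ore.rep_eq)

lemma obar_nth_0 [simp]: "obar_nth 0 a = 0"
  by transfer (auto simp: zero_ore.rep_eq)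

lemma obar_nth_theta_power:
  "obar_nth (obar_theta ^ b :: ('k::{alg_closed_field,field_prime_char}, 'n::finite) ore_bar) a
     = (if a = b \<and> a < CARD('n) then 1 else 0)"
  using obar_nth_theta_power_times[of b "1 :: ('k, 'n) ore_bar" a]
  by (auto simp: power_0_left)

lemma obar_theta_power_card [simp]:
  "(obar_theta :: ('k::{alg_closed_field,field_prime_char}, 'n::finite) ore_bar) ^ CARD('n) = 0"
  by (rule obar_eqI) (simp add: obar_nth_theta_power)

lemma obar_nth_const [simp]:
  "obar_nth (obar_const c :: ('k::{alg_closed_field,field_prime_char}, 'n::finite) ore_bar) a
     = (if a = 0 then c else 0)"
  using obar_nth_const_times[of c "1 :: ('k, 'n) ore_bar" a] by simp

lemma obar_nth_sum [simp]:
  "obar_nth (sum f A) a = (\<Sum>i\<in>A. obar_nth (f i) a)"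
  by (induction A rule: infinite_finite_induct) simp_all

lemma obar_expand:
  fixes x :: "('k::{alg_closed_field,field_prime_char}, 'n::finite) ore_bar"
  shows "x = (\<Sum>a<CARD('n). obar_const (obar_nth x a) * obar_theta ^ a)"
  by (rule obar_eqI) (simp add: obar_nth_theta_power if_distrib cong: if_cong)

lemma obar_const_add: "obar_const (c + d) = obar_const c + obar_const d"
  by (rule obar_eqI) simp

lemma obar_const_mult: "obar_const (c * d) = obar_const c * obar_const d"
  by (rule obar_eqI) (simp del: obar_nth_times_const)

lemma obar_const_1 [simp]: "obar_const 1 = 1"
  by (rule obar_eqI) simp

lemma obar_theta_power_const:
  "(obar_theta :: ('k::{alg_closed_field,field_prime_char}, 'n::finite) ore_bar) ^ a * obar_const c
     = obar_const (c ^ (CHAR('k) ^ a)) * obar_theta ^ a"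
  by (rule obar_eqI) (simp add: obar_nth_theta_power)


section \<open>Frobenius twists and iterates of a p-linear map of rows\<close>

definition frob_row :: "nat \<Rightarrow> 'r::comm_ring_1^'n \<Rightarrow> 'r^'n" where
  "frob_row q m = (\<chi> i. m $ i ^ q)"

lemma frob_row_nth [simp]: "frob_row q m $ i = m $ i ^ q"
  by (simp add: frob_row_def)

lemma frob_mat_nth [simp]: "frob_mat q B $ i $ j = B $ i $ j ^ q"
  by (simp add: frob_mat_def)

lemma frob_row_1 [simp]: "frob_row (Suc 0) m = m"
  by (simp add: vec_eq_iff)

lemma row_map_eq: "row_map p B m = frob_row p m v* B"
  by (simp add: row_map_def frob_row_def)

lemma axis_vector_matrix [simp]: "axis j 1 v* B = B $ j"
  for B :: "'r::comm_ring_1^'n::finite^'m::finite"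
  by (simp add: vec_eq_iff vector_matrix_mult_def axis_def if_distrib[of "\<lambda>x. x * _"] cong: if_cong)

lemma scalar_vector_matrix: "(r *s m) v* B = r *s (m v* B)"
  for B :: "'r::comm_ring_1^'n::finite^'m::finite"
  by (simp add: vec_eq_iff vector_matrix_mult_def sum_distrib_left mult.assoc)

lemma scalar_sum_right: "r *s sum f A = (\<Sum>i\<in>A. r *s f i)"
  for f :: "'i \<Rightarrow> 'r::comm_ring_1^'n"
  by (simp add: vec_eq_iff sum_distrib_left)

lemma frob_row_axis [simp]: "q > 0 \<Longrightarrow> frob_row q (axis j 1) = axis j 1"
  by (simp add: vec_eq_iff axis_def power_0_left)

locale frobenius_ring =
  fixes p :: nat and R :: "'r::comm_ring_1 itself"
  assumes prime_char: "prime CHAR('r)" and p_char: "p = CHAR('r)"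
begin

lemma p_pos [simp]: "0 < p"
  using prime_char p_char prime_gt_0_nat by blast

lemma p_nonzero [simp]: "p \<noteq> 0"
  using p_pos by blast

lemma frob_add: "(x + y) ^ (p ^ c) = x ^ (p ^ c) + y ^ (p ^ c)" for x y :: 'r
  by (rule freshmans_dream') (use prime_char p_char in auto)

lemma frob_sum: "sum f A ^ (p ^ c) = (\<Sum>i\<in>A. f i ^ (p ^ c))" for f :: "'i \<Rightarrow> 'r"
  by (rule freshmans_dream_sum') (use prime_char p_char in auto)

lemma frob_row_times:
  "frob_row (p ^ c) (m v* B) = frob_row (p ^ c) m v* frob_mat (p ^ c) B"
  for B :: "'r^'n::finite^'m::finite"
  by (simp add: vec_eq_iff vector_matrix_mult_def frob_sum power_mult_distrib)

lemma frob_mat_times: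
  "frob_mat (p ^ c) (A ** B) = frob_mat (p ^ c) A ** frob_mat (p ^ c) B"
  for A :: "'r^'n::finite^'m::finite"
  by (simp add: vec_eq_iff matrix_matrix_mult_def frob_sum power_mult_distrib)

lemma frob_row_row: "frob_row (p ^ c) (frob_row p m) = frob_row (p ^ Suc c) m" for m :: "'r^'n"
  by (simp add: vec_eq_iff power_mult[symmetric] mult.commute)

text \<open>
  Peeling the innermost application off \<open>\<phi>\<^bsup>c+1\<^esup>(m) = \<phi>\<^sup>c(m\<^bsup>[p]\<^esup> B)\<close> puts the highest twist of \<open>B\<close> on
  the left, in agreement with the recursion for \<open>frob_prod\<close>.
\<close>

lemma row_map_power:
  "(row_map p B ^^ c) m = frob_row (p ^ c) m v* frob_prod p B c" for B :: "'r^'n::finite^'n"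
proof (induction c arbitrary: m)
  case (Suc c)
  have "(row_map p B ^^ Suc c) m = frob_row (p ^ c) (row_map p B m) v* frob_prod p B c"
    unfolding funpow_Suc_right o_apply Suc ..
  then show ?case
    by (simp only: row_map_eq[of p B m] frob_row_times frob_row_row vector_matrix_mul_assoc
        frob_prod.simps)
qed simp

lemma row_map_power_axis: "(row_map p B ^^ c) (axis j 1) = frob_prod p B c $ j"
  for B :: "'r^'n::finite^'n"
  by (simp add: row_map_power)

lemma row_map_add: "row_map p B (m + m') = row_map p B m + row_map p B m'" for B :: "'r^'n::finite^'n"
  using frob_add[where c = 1]
  by (simp add: row_map_def vec_eq_iff vector_matrix_mult_def algebra_simps sum.distrib)

sublocale row_map: Modules.additive "row_map p B" for B :: "'r^'n::finite^'n"
  by standard (rule row_map_add)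

lemma row_map_scale: "row_map p B (c *s m) = (c ^ p) *s row_map p B m" for B :: "'r^'n::finite^'n"
  by (simp add: row_map_def vec_eq_iff vector_matrix_mult_def power_mult_distrib sum_distrib_left mult.assoc)

text \<open>
  Over a general ring the equation on matrices is recovered from the unit rows, which the Frobenius
  map fixes.
\<close>

lemma nilp_points_iff:
  "B \<in> nilp_points p \<longleftrightarrow> (\<forall>m. (row_map p B ^^ CARD('n)) m = 0)" for B :: "'r^'n::finite^'n"
proof
  assume "\<forall>m. (row_map p B ^^ CARD('n)) m = 0"
  then have "frob_prod p B CARD('n) $ j = 0" for j
    by (metis row_map_power_axis)
  then show "B \<in> nilp_points p"
    by (simp add: nilp_points_def vec_eq_iff)
qed (simp add: nilp_points_def row_map_power)

end

section \<open>Complements of V stable under theta\<close>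

text \<open>
  The structure of the base change of \<open>\<FF>\<close> that the correspondence depends on: \<open>emb\<close> embeds the rows
  as level \<open>0\<close>, the powers of the \<open>p\<close>-linear map \<open>th\<close> produce the higher levels, and \<open>co a\<close> reads
  off level \<open>a\<close>.
\<close>

locale theta_module =
  Modules.module sc + frobenius_ring p "TYPE('r)"
  for p :: nat and sc :: "'r::comm_ring_1 \<Rightarrow> 'f::ab_group_add \<Rightarrow> 'f" +
  fixes th :: "'f \<Rightarrow> 'f" and emb :: "'r^'n::finite \<Rightarrow> 'f" and co :: "nat \<Rightarrow> 'f \<Rightarrow> 'r^'n"
  assumes th_add: "th (x + y) = th x + th y" and th_scale: "th (sc r x) = sc (r ^ p) (th x)"
    and emb_add: "emb (m + m') = emb m + emb m'" and emb_scale: "emb (r *s m) = sc r (emb m)"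
    and co_add: "co a (x + y) = co a x + co a y" and co_scale: "co a (sc r x) = r *s co a x"
    and co_level: "a < CARD('n) \<Longrightarrow> co b ((th ^^ a) (emb m)) = (if a = b then frob_row (p ^ a) m else 0)"
    and th_nilpotent: "(th ^^ CARD('n)) (emb m) = 0"
    and expand: "x = (\<Sum>a<CARD('n). \<Sum>j\<in>UNIV. sc (co a x $ j) ((th ^^ a) (emb (axis j 1))))"
begin

sublocale th: Modules.additive th by standard (rule th_add)
sublocale emb: Modules.additive emb by standard (rule emb_add)
sublocale co: Modules.additive "co a" for a by standard (rule co_add)

text \<open>The retraction onto \<open>V\<close> whose kernel is \<open>\<LL>(\<phi>)\<close>.\<close>

definition proj :: "'r^'n^'n \<Rightarrow> 'f \<Rightarrow> 'r^'n" where
  "proj B x = (\<Sum>a<CARD('n). co a x v* frob_prod p B a)"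

text \<open>\<open>\<LL>(\<phi>)\<close> for the map \<open>\<phi>\<close> of rows given by \<open>B\<close>.\<close>

definition relation_span :: "'r^'n^'n \<Rightarrow> 'f set" where
  "relation_span B = span {(th ^^ (a + b)) (emb ((row_map p B ^^ c) m))
      - (th ^^ a) (emb ((row_map p B ^^ (b + c)) m)) | m a b c. True}"

lemma proj_add: "proj B (x + y) = proj B x + proj B y"
  by (simp add: proj_def co_add vector_matrix_left_distrib sum.distrib)

sublocale proj: Modules.additive "proj B" for B
  by standard (rule proj_add)

lemma proj_scale: "proj B (sc r x) = r *s proj B x"
  by (simp add: proj_def co_scale scalar_vector_matrix scalar_sum_right)

lemma th_power_zero [simp]: "(th ^^ a) 0 = 0"
  by (induction a) (simp_all add: th.zero)

lemma row_map_power_zero [simp]: "(row_map p B ^^ a) 0 = (0 :: 'r^'n)"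
  by (induction a) (simp_all add: row_map.zero)

lemma th_power_beyond: "CARD('n) \<le> a \<Longrightarrow> (th ^^ a) (emb m) = 0"
  using funpow_add[of "a - CARD('n)" "CARD('n)" th] th_nilpotent by simp

lemma row_map_power_beyond:
  fixes B :: "'r^'n^'n"
  assumes "B \<in> nilp_points p" "CARD('n) \<le> a"
  shows "(row_map p B ^^ a) m = 0"
  using funpow_add[of "a - CARD('n)" "CARD('n)" "row_map p B"] assms nilp_points_iff[of B] by simp

text \<open>For \<open>a \<ge> n\<close> both sides vanish, the right one by nilpotence.\<close>

lemma proj_level:
  assumes "B \<in> nilp_points p"
  shows "proj B ((th ^^ a) (emb m)) = (row_map p B ^^ a) m"
proof (cases "a < CARD('n)")
  case True
  then have "proj B ((th ^^ a) (emb m))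
      = (\<Sum>b<CARD('n). if a = b then (row_map p B ^^ a) m else 0)"
    unfolding proj_def by (intro sum.cong refl) (simp add: co_level row_map_power)
  with True show ?thesis by simp
next
  case False
  with assms show ?thesis
    by (simp add: th_power_beyond row_map_power_beyond proj.zero)
qed

lemma proj_emb [simp]: "B \<in> nilp_points p \<Longrightarrow> proj B (emb m) = m"
  using proj_level[of B 0 m] by simp

text \<open>
  Both sides are \<open>p\<close>-linear in \<open>x\<close>, so it suffices to compare them on the elements \<open>\<theta>\<^sup>a \<otimes> e\<^sub>j\<close>, where
  both are \<open>\<phi>\<^bsup>a+1\<^esup>(e\<^sub>j)\<close>.
\<close>

lemma proj_th:
  assumes "B \<in> nilp_points p"
  shows "proj B (th x) = row_map p B (proj B x)"
proof -
  let ?e = "\<lambda>a j. (th ^^ a) (emb (axis j 1))"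
  have lv: "proj B (?e a j) = frob_prod p B a $ j" for a j
    using assms by (simp add: proj_level row_map_power_axis)
  have lv': "proj B (th (?e a j)) = row_map p B (frob_prod p B a $ j)" for a j
    using proj_level[OF assms, of "Suc a" "axis j 1"] row_map_power_axis[of a B j] by simp
  have "proj B (th x) = proj B (th (\<Sum>a<CARD('n). \<Sum>j\<in>UNIV. sc (co a x $ j) (?e a j)))"
    by (simp flip: expand)
  also have "\<dots> = (\<Sum>a<CARD('n). \<Sum>j\<in>UNIV. (co a x $ j ^ p) *s row_map p B (frob_prod p B a $ j))"
    by (simp add: th.sum proj.sum th_scale proj_scale lv')
  also have "\<dots> = row_map p B (\<Sum>a<CARD('n). \<Sum>j\<in>UNIV. (co a x $ j) *s (frob_prod p B a $ j))"
    by (simp add: row_map.sum row_map_scale)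
  also have "(\<Sum>a<CARD('n). \<Sum>j\<in>UNIV. (co a x $ j) *s (frob_prod p B a $ j))
      = proj B (\<Sum>a<CARD('n). \<Sum>j\<in>UNIV. sc (co a x $ j) (?e a j))"
    by (simp add: proj.sum proj_scale lv)
  also have "\<dots> = proj B x"
    by (simp flip: expand)
  finally show ?thesis .
qed

lemma subspace_relation_span: "subspace (relation_span B)"
  by (simp add: relation_span_def)

lemma level_cong_relation_span:
  "(th ^^ a) (emb m) - emb ((row_map p B ^^ a) m) \<in> relation_span B"
  unfolding relation_span_def
proof (rule span_base)
  show "(th ^^ a) (emb m) - emb ((row_map p B ^^ a) m)
      \<in> {(th ^^ (a + b)) (emb ((row_map p B ^^ c) m))
      - (th ^^ a) (emb ((row_map p B ^^ (b + c)) m)) | m a b c. True}"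
    by (rule CollectI, rule exI[of _ m], rule exI[of _ 0], rule exI[of _ a], rule exI[of _ 0]) simp
qed

text \<open>
  This writes an element of the kernel of \<open>proj B\<close> explicitly as a combination of generators of
  \<open>relation_span B\<close>.
\<close>

lemma expand_minus_proj:
  assumes "B \<in> nilp_points p"
  shows "x - emb (proj B x) = (\<Sum>a<CARD('n). \<Sum>j\<in>UNIV. sc (co a x $ j)
           ((th ^^ a) (emb (axis j 1)) - emb ((row_map p B ^^ a) (axis j 1))))"
proof -
  let ?e = "\<lambda>a j. (th ^^ a) (emb (axis j 1))"
  have x: "x = (\<Sum>a<CARD('n). \<Sum>j\<in>UNIV. sc (co a x $ j) (?e a j))"
    by (rule expand)
  have "proj B x = (\<Sum>a<CARD('n). \<Sum>j\<in>UNIV. (co a x $ j) *s ((row_map p B ^^ a) (axis j 1)))"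
    by (subst x) (simp add: proj.sum proj_scale proj_level[OF assms])
  then have "emb (proj B x) = (\<Sum>a<CARD('n). \<Sum>j\<in>UNIV. sc (co a x $ j) (emb ((row_map p B ^^ a) (axis j 1))))"
    by (simp add: emb.sum emb_scale)
  then show ?thesis
    by (subst x) (simp add: scale_right_diff_distrib sum_subtractf)
qed

lemma relation_span_eq_kernel:
  assumes "B \<in> nilp_points p"
  shows "relation_span B = {x. proj B x = 0}"
proof
  have "subspace {x. proj B x = 0}"
    by (auto simp: subspace_def proj.zero proj_add proj_scale)
  then show "relation_span B \<subseteq> {x. proj B x = 0}"
    unfolding relation_span_def
    by (rule span_minimal[rotated]) (auto simp: proj.diff proj_level[OF assms] funpow_add[where f = "row_map p B"] ac_simps)
  have "x - emb (proj B x) \<in> relation_span B" for x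
    unfolding expand_minus_proj[OF assms]
    by (intro subspace_sum subspace_scale subspace_relation_span level_cong_relation_span)
  then show "{x. proj B x = 0} \<subseteq> relation_span B"
    by (auto simp: emb.zero) (metis diff_zero emb.zero)
qed

lemma relation_span_stable: "B \<in> nilp_points p \<Longrightarrow> th ` relation_span B \<subseteq> relation_span B"
  by (auto simp: relation_span_eq_kernel proj_th row_map.zero)

lemma relation_span_Int_emb: "B \<in> nilp_points p \<Longrightarrow> relation_span B \<inter> range emb = {0}"
  by (auto simp: relation_span_eq_kernel emb.zero proj.zero intro: range_eqI[of _ _ 0])

lemma relation_span_complement: 
  assumes "B \<in> nilp_points p"
  shows "\<exists>y\<in>relation_span B. \<exists>v\<in>range emb. x = y + v"
proof
  show "x - emb (proj B x) \<in> relation_span B"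
    using assms by (simp add: relation_span_eq_kernel proj.diff)
  show "\<exists>v\<in>range emb. x = x - emb (proj B x) + v"
    by simp
qed

text \<open>Applying \<open>proj C\<close> to \<open>\<theta> \<otimes> e\<^sub>j - 1 \<otimes> B\<^sub>j\<close> identifies the rows of \<open>B\<close> and \<open>C\<close>.\<close>

lemma inj_on_relation_span: "inj_on relation_span (nilp_points p)"
proof
  fix B C :: "'r^'n^'n"
  assume B: "B \<in> nilp_points p" and C: "C \<in> nilp_points p" and eq: "relation_span B = relation_span C"
  have "B $ j = C $ j" for j
  proof -
    have "th (emb (axis j 1)) - emb (B $ j) \<in> relation_span C"
      using level_cong_relation_span[of 1 "axis j 1" B] by (simp add: row_map_eq eq)
    then have "proj C (th (emb (axis j 1))) = B $ j"
      using C by (simp add: relation_span_eq_kernel proj.diff)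
    then show ?thesis
      using C by (simp add: proj_th row_map_eq)
  qed
  then show "B = C"
    by (simp add: vec_eq_iff)
qed

text \<open>
  The projection \<open>\<pi>\<close> along \<open>L\<close> carries \<open>\<theta>\<close> to the map \<open>m \<mapsto> \<pi>(\<theta> \<otimes> m)\<close>, which is \<open>p\<close>-linear and therefore
  given by a matrix \<open>B\<close>.  Nilpotence of \<open>\<theta>\<close> passes to \<open>B\<close>, and \<open>\<pi> = proj B\<close>.
\<close>

lemma complement_is_relation_span:
  assumes L: "subspace L" "th ` L \<subseteq> L" "L \<inter> range emb = {0}"
    and sum: "\<And>x. \<exists>y\<in>L. \<exists>v\<in>range emb. x = y + v"
  obtains B where "B \<in> nilp_points p" "L = relation_span B"
proof -
  have "\<exists>m. x - emb m \<in> L" for x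
  proof -
    obtain y m where "y \<in> L" "x = y + emb m"
      using sum[of x] by auto
    then show ?thesis by (intro exI[of _ m]) simp
  qed
  then obtain \<pi> where \<pi>: "x - emb (\<pi> x) \<in> L" for x
    by metis
  \<comment> \<open>Level \<open>0\<close> recovers \<open>m\<close> from \<open>emb m\<close>, so \<open>emb\<close> is injective.\<close>
  have emb_L: "m = 0" if "emb m \<in> L" for m
  proof -
    have "emb m = 0" using that L(3) by blast
    then have "co 0 (emb m) = 0" by (simp add: co.zero)
    with co_level[of 0 0 m] show ?thesis by simp
  qed
  have \<pi>_eq: "\<pi> x = m" if "x - emb m \<in> L" for x m
  proof -
    have "(x - emb m) - (x - emb (\<pi> x)) \<in> L"
      by (rule subspace_diff[OF L(1) that \<pi>])
    then have "emb (\<pi> x - m) \<in> L" by (simp add: emb.diff)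
    then show ?thesis using emb_L by fastforce
  qed
  have \<pi>_emb: "\<pi> (emb m) = m" for m
    using L(1) by (intro \<pi>_eq) (simp add: subspace_0)
  have \<pi>_0: "\<pi> x = 0 \<longleftrightarrow> x \<in> L" for x
    using \<pi>[of x] \<pi>_eq[of x 0] by (auto simp: emb.zero)
  have \<pi>_add: "\<pi> (x + y) = \<pi> x + \<pi> y" for x y
    using subspace_add[OF L(1) \<pi>[of x] \<pi>[of y]]
    by (intro \<pi>_eq) (simp add: emb.add algebra_simps)
  interpret \<pi>: Modules.additive \<pi> by standard (rule \<pi>_add)
  have \<pi>_scale: "\<pi> (sc r x) = r *s \<pi> x" for r x
    using subspace_scale[OF L(1) \<pi>[of x], of r]
    by (intro \<pi>_eq) (simp add: emb_scale scale_right_diff_distrib)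
  define B :: "'r^'n^'n" where "B = (\<chi> j. \<pi> (th (emb (axis j 1))))"
  have \<pi>_th_emb: "\<pi> (th (emb m)) = row_map p B m" for m
  proof -
    have m: "m = (\<Sum>j\<in>UNIV. m $ j *s axis j 1)"
      by (simp add: vec_eq_iff axis_def if_distrib cong: if_cong)
    have "\<pi> (th (emb m)) = (\<Sum>j\<in>UNIV. (m $ j ^ p) *s (B $ j))"
      by (subst m) (simp add: emb.sum th.sum \<pi>.sum emb_scale th_scale \<pi>_scale B_def)
    then show ?thesis
      by (simp add: row_map_eq vec_eq_iff vector_matrix_mult_def)
  qed
  have \<pi>_th: "\<pi> (th x) = row_map p B (\<pi> x)" for x
  proof -
    have "th (x - emb (\<pi> x)) \<in> L" using \<pi> L(2) by blast
    then have "\<pi> (th x - th (emb (\<pi> x))) = 0" by (simp add: \<pi>_0 th.diff)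
    then show ?thesis by (simp add: \<pi>.diff \<pi>_th_emb)
  qed
  have \<pi>_level: "\<pi> ((th ^^ a) (emb m)) = (row_map p B ^^ a) m" for a m
    by (induction a) (simp_all add: \<pi>_emb \<pi>_th)
  have B: "B \<in> nilp_points p"
    using \<pi>_level[of "CARD('n)"] by (simp add: nilp_points_iff th_nilpotent \<pi>.zero)
  have "\<pi> x = proj B x" for x
    unfolding arg_cong[OF expand[of x], of \<pi>] arg_cong[OF expand[of x], of "proj B"]
    by (simp add: \<pi>.sum \<pi>_scale \<pi>_level proj.sum proj_scale proj_level[OF B])
  then have "L = relation_span B"
    using \<pi>_0 by (auto simp: relation_span_eq_kernel[OF B])
  with B show ?thesis by (rule that)
qed

text \<open>
  The quotient by a complement of \<open>V\<close> is free on the images of the basis of \<open>V\<close>, so the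
  covering by basic open sets can be taken trivial.
\<close>

lemma complement_locally_free:
  assumes L: "subspace L" "L \<inter> range emb = {0}"
    and sum: "\<And>x. \<exists>y\<in>L. \<exists>v\<in>range emb. x = y + v"
  shows "locally_free_quotient sc L CARD('n)"
proof -
  obtain h :: "nat \<Rightarrow> 'n" where h: "bij_betw h {..<CARD('n)} UNIV"
    using ex_bij_betw_nat_finite[of "UNIV :: 'n set"] by (auto simp: atLeast0LessThan)
  let ?b = "\<lambda>i. emb (axis (h i) 1)"
  have comb: "(\<Sum>i<CARD('n). sc (c i) (?b i)) = emb (\<chi> j. c (inv_into {..<CARD('n)} h j))" for c
  proof -
    have "(\<Sum>i<CARD('n). sc (c i) (?b i))
        = (\<Sum>i<CARD('n). sc (c (inv_into {..<CARD('n)} h (h i))) (emb (axis (h i) 1)))"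
      using h by (intro sum.cong refl) (simp add: bij_betw_inv_into_left)
    also have "\<dots> = (\<Sum>j\<in>UNIV. sc (c (inv_into {..<CARD('n)} h j)) (emb (axis j 1)))"
      by (rule sum.reindex_bij_betw[OF h])
    also have "\<dots> = emb (\<Sum>j\<in>UNIV. c (inv_into {..<CARD('n)} h j) *s axis j 1)"
      by (simp add: emb.sum emb_scale)
    also have "(\<Sum>j\<in>UNIV. c (inv_into {..<CARD('n)} h j) *s axis j 1) = (\<chi> j. c (inv_into {..<CARD('n)} h j))"
      by (simp add: vec_eq_iff axis_def if_distrib cong: if_cong)
    finally show ?thesis .
  qed
  have "\<exists>N c. sc (1 ^ N) x - (\<Sum>i<CARD('n). sc (c i) (?b i)) \<in> L" for x
  proof -
    obtain y m where y: "y \<in> L" "x = y + emb m"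
      using sum[of x] by auto
    have "(\<chi> j. m $ h (inv_into {..<CARD('n)} h j)) = m"
      using h by (simp add: vec_eq_iff bij_betw_inv_into_right)
    then have "sc (1 ^ 0) x - (\<Sum>i<CARD('n). sc (m $ h i) (?b i)) \<in> L"
      using y comb[of "\<lambda>i. m $ h i"] by simp
    then show ?thesis by (intro exI)
  qed
  moreover have "c i = 0" if "(\<Sum>i<CARD('n). sc (c i) (?b i)) \<in> L" "i < CARD('n)" for c i
  proof -
    let ?m = "\<chi> j. c (inv_into {..<CARD('n)} h j)"
    have "emb ?m = 0" using that(1) L(2) unfolding comb by blast
    then have "co 0 (emb ?m) = 0" by (simp add: co.zero)
    then have "?m = 0" using co_level[of 0 0 ?m] by simp
    then have "?m $ h i = 0" by simp
    then show ?thesis using h that(2) by (simp add: bij_betw_inv_into_left)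
  qed
  ultimately show ?thesis
    unfolding locally_free_quotient_def
    by (intro exI[of _ "{1}"] conjI ballI exI[of _ "\<lambda>_. 1"] exI[of _ ?b]) auto
qed

end


section \<open>Coordinates on the truncated free module and on its base changes\<close>

locale fbar =
  V: vector_space scaleV + tensor obar_ract scaleV t
  for scaleV :: "'k::{alg_closed_field,field_prime_char} \<Rightarrow> 'v::ab_group_add \<Rightarrow> 'v"
    and t :: "('k, 'n::finite) ore_bar \<Rightarrow> 'v \<Rightarrow> 'f::ab_group_add" +
  fixes p :: nat and e :: "'n \<Rightarrow> 'v"
  assumes p_CHAR: "p = CHAR('k)" and basis: "is_basis scaleV e"
begin

sublocale k: frobenius_ring p "TYPE('k)"
  by standard (simp_all add: p_CHAR)

definition coord :: "'v \<Rightarrow> 'k^'n" where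
  "coord v = (\<chi> j. V.representation (range e) v (e j))"

lemma independent: "V.independent (range e)" and span: "V.span (range e) = UNIV" and inj: "inj e"
  using basis unfolding is_basis_def by auto

lemma sum_coord: "(\<Sum>j\<in>UNIV. scaleV (coord v $ j) (e j)) = v"
proof -
  have "(\<Sum>j\<in>UNIV. scaleV (coord v $ j) (e j)) = (\<Sum>b\<in>range e. scaleV (V.representation (range e) v b) b)"
    using inj by (simp add: coord_def sum.reindex)
  also have "\<dots> = v"
    by (rule V.sum_representation_eq) (auto simp: independent span)
  finally show ?thesis .
qed

lemma coord_add: "coord (v + w) = coord v + coord w"
  by (simp add: vec_eq_iff coord_def V.representation_add independent span)

sublocale coord: Modules.additive coord
  by standard (rule coord_add)

lemma coord_scale: "coord (scaleV c v) = c *s coord v"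
  by (simp add: vec_eq_iff coord_def V.representation_scale independent span)

lemma coord_e [simp]: "coord (e j) = axis j 1"
  using inj by (auto simp: vec_eq_iff coord_def V.representation_basis independent axis_def inj_eq)

lemma coord_sum [simp]: "coord (\<Sum>j\<in>UNIV. scaleV (m $ j) (e j)) = m"
  by (simp add: coord.sum coord_scale) (simp add: vec_eq_iff axis_def if_distrib cong: if_cong)

lemma coord_inj: "coord v = coord w \<Longrightarrow> v = w"
  by (metis sum_coord)

lemma balanced_const: "t (x * obar_const c) v = t x (scaleV c v)"
  using balanced by (simp add: obar_ract_def)

text \<open>Left and right multiplication on the truncated Ore ring commute, so the action is well defined.\<close>

lemma additive_obar_act: "Modules.additive (obar_act t y)"
  and obar_act_pure [simp]: "obar_act t y (t x v) = t (y * x) v"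
proof -
  have "t (y * obar_ract x c) v = t (y * x) (scaleV c v)" for x c v
    unfolding balanced_const[symmetric] by (simp add: obar_ract_def mult.assoc)
  then show "Modules.additive (obar_act t y)" "obar_act t y (t x v) = t (y * x) v"
    unfolding obar_act_def by (intro tensor_map; simp add: distrib_left add_left add_right)+
qed

sublocale act: Modules.additive "obar_act t y" for y
  by (rule additive_obar_act)

lemma obar_act_mult: "obar_act t (y * z) f = obar_act t y (obar_act t z f)"
  by (induction f rule: induct) (simp_all add: act.diff mult.assoc)

lemma obar_act_add: "obar_act t (y + z) f = obar_act t y f + obar_act t z f"
  by (induction f rule: induct) (simp_all add: act.diff distrib_right add_left)

lemma obar_act_1 [simp]: "obar_act t 1 f = f"
  by (induction f rule: induct) (simp_all add: act.diff)

lemma obar_act_sum: "obar_act t (sum y A) f = (\<Sum>i\<in>A. obar_act t (y i) f)"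
proof -
  interpret Modules.additive "\<lambda>y. obar_act t y f"
    by standard (rule obar_act_add)
  show ?thesis by (rule sum)
qed

lemma fbar_scale_pure [simp]: "fbar_scale t c (t x v) = t (obar_const c * x) v"
  by (simp add: fbar_scale_def)

sublocale F: vector_space "fbar_scale t"
  by standard (simp_all add: fbar_scale_def obar_const_add obar_const_mult obar_act_add obar_act_mult act.add)

lemma theta_power_const:
  "(obar_theta :: ('k, 'n) ore_bar) ^ a * obar_const c = obar_const (c ^ (p ^ a)) * obar_theta ^ a"
  by (simp add: p_CHAR obar_theta_power_const)

lemma obar_theta_scale:
  "obar_act t obar_theta (fbar_scale t c f) = fbar_scale t (c ^ p) (obar_act t obar_theta f)"
proof -
  have "(obar_theta :: ('k, 'n) ore_bar) * obar_const c = obar_const (c ^ p) * obar_theta"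
    using theta_power_const[of 1 c] by simp
  then show ?thesis
    by (simp add: fbar_scale_def flip: obar_act_mult)
qed

lemma fbar_scale_V: "fbar_scale t c (t 1 v) = t 1 (scaleV c v)"
  using balanced_const[of 1] by simp

text \<open>
  The row \<open>x\<^sub>a\<close> in \<open>\<Sum>a. \<theta>\<^sup>a \<otimes> x\<^sub>a\<close>, with left coefficients: moving \<open>v\<close> to the left past \<open>\<theta>\<^sup>a\<close> twists its
  coordinates by \<open>p\<^sup>a\<close>.  The same twist occurs in the right \<open>k\<close>-action, which makes it balanced.
\<close>

definition level :: "nat \<Rightarrow> 'f \<Rightarrow> 'k^'n" where
  "level a = tensor_map t (\<lambda>x v. obar_nth x a *s frob_row (p ^ a) (coord v)) (\<lambda>x. x) (\<lambda>v. v)"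

lemma additive_level: "Modules.additive (level a)"
  and level_pure [simp]: "level a (t x v) = obar_nth x a *s frob_row (p ^ a) (coord v)"
proof -
  let ?\<beta> = "\<lambda>(x :: ('k, 'n) ore_bar) v. obar_nth x a *s frob_row (p ^ a) (coord v)"
  have "?\<beta> (x + y) v = ?\<beta> x v + ?\<beta> y v" "?\<beta> x (v + w) = ?\<beta> x v + ?\<beta> x w"
    "?\<beta> (obar_ract x c) v = ?\<beta> x (scaleV c v)" for x y v w c
    by (simp_all add: vec_eq_iff coord_add coord_scale k.frob_add power_mult_distrib
        obar_ract_def algebra_simps flip: p_CHAR)
  from tensor_map_bilinear[of ?\<beta>, OF this]
  show "Modules.additive (level a)" "level a (t x v) = obar_nth x a *s frob_row (p ^ a) (coord v)"
    unfolding level_def by auto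
qed

sublocale level: Modules.additive "level a" for a
  by (rule additive_level)

lemma level_scale: "level a (fbar_scale t c f) = c *s level a f"
  by (induction f rule: induct) (simp_all add: F.scale_right_diff_distrib level.diff vec_eq_iff algebra_simps)

text \<open>
  On a pure tensor this is the expansion of \<open>x\<close> in powers of \<open>\<theta>\<close> and of \<open>v\<close> in the basis, after the
  coordinates of \<open>v\<close> are moved to the left.
\<close>

lemma level_expand:
  "f = (\<Sum>a<CARD('n). \<Sum>j\<in>UNIV. fbar_scale t (level a f $ j) (t (obar_theta ^ a) (e j)))"
proof (induction f rule: induct)
  case (pure x v)
  have "(\<Sum>j\<in>UNIV. fbar_scale t (level a (t x v) $ j) (t (obar_theta ^ a) (e j)))
      = t (obar_const (obar_nth x a) * obar_theta ^ a) v" for a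
  proof -
    have "fbar_scale t (level a (t x v) $ j) (t (obar_theta ^ a) (e j))
        = t (obar_const (obar_nth x a) * obar_theta ^ a) (scaleV (coord v $ j) (e j))" for j
      by (simp add: obar_const_mult mult.assoc flip: theta_power_const balanced_const)
    then show ?thesis
      by (simp add: sum_coord flip: right.sum)
  qed
  then show ?case
    by (simp flip: left.sum obar_expand)
next
  case (diff f g)
  then show ?case
    by (simp add: level.diff F.scale_left_diff_distrib sum_subtractf del: fbar_scale_pure)
qed

end

locale fbar_base_change = fbar scaleV t p e
  for scaleV :: "'k::{alg_closed_field,field_prime_char} \<Rightarrow> 'v::ab_group_add \<Rightarrow> 'v"
    and t :: "('k, 'n::finite) ore_bar \<Rightarrow> 'v \<Rightarrow> 'f::ab_group_add"
    and p :: nat and e :: "'n \<Rightarrow> 'v" +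
  fixes \<eta> :: "'k \<Rightarrow> 'r::comm_ring_1" and tR :: "'f \<Rightarrow> 'r \<Rightarrow> 'fr::ab_group_add"
  assumes bc: "base_change t \<eta> tR"
begin

sublocale R: tensor "\<lambda>x c. fbar_scale t c x" "\<lambda>c r. \<eta> c * r" tR
  by standard (use bc in \<open>simp add: base_change_def\<close>)

lemma \<eta>_1 [simp]: "\<eta> 1 = 1" and \<eta>_add: "\<eta> (x + y) = \<eta> x + \<eta> y" and \<eta>_mult: "\<eta> (x * y) = \<eta> x * \<eta> y"
  using bc by (auto simp: base_change_def is_ring_hom_def)

sublocale \<eta>: Modules.additive \<eta>
  by standard (rule \<eta>_add)

lemma \<eta>_power: "\<eta> (x ^ i) = \<eta> x ^ i"
  by (induction i) (simp_all add: \<eta>_mult)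

text \<open>
  The characteristic of \<open>R\<close> divides \<open>p\<close> and is not \<open>1\<close>, as the zero ring is excluded by the type class.
\<close>

sublocale frobenius_ring p "TYPE('r)"
proof
  have \<eta>_nat: "\<eta> (of_nat i) = of_nat i" for i
    by (induction i) (simp_all add: \<eta>.zero \<eta>_add)
  have "of_nat p = (0::'r)"
    using \<eta>_nat[of p] by (simp add: p_CHAR \<eta>.zero)
  then have "CHAR('r) dvd p"
    by (simp add: of_nat_eq_0_iff_char_dvd)
  moreover have "prime p"
    by (simp add: p_CHAR)
  moreover have "CHAR('r) \<noteq> 1"
    by (metis of_nat_1 of_nat_CHAR zero_neq_one)
  ultimately show "p = CHAR('r)" "prime CHAR('r)"
    by (metis prime_nat_iff)+
qed

lemma additive_bc_scale: "Modules.additive (bc_scale tR r)"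
  and bc_scale_pure [simp]: "bc_scale tR r (tR x s) = tR x (r * s)"
proof -
  have "tR (fbar_scale t c x) (r * s) = tR x (r * (\<eta> c * s))" for x c s
    by (simp add: R.balanced mult.left_commute)
  then show "Modules.additive (bc_scale tR r)" "bc_scale tR r (tR x s) = tR x (r * s)"
    unfolding bc_scale_def by (intro R.tensor_map; simp add: distrib_left R.add_left R.add_right)+
qed

sublocale bc_scale: Modules.additive "bc_scale tR r" for r
  by (rule additive_bc_scale)

sublocale M: Modules.module "bc_scale tR"
proof
  fix r s :: 'r and x y :: 'fr
  show "bc_scale tR r (x + y) = bc_scale tR r x + bc_scale tR r y"
    by (rule bc_scale.add)
  show "bc_scale tR (r + s) x = bc_scale tR r x + bc_scale tR s x"
    by (induction x rule: R.induct) (simp_all add: bc_scale.diff distrib_right R.add_right)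
  show "bc_scale tR r (bc_scale tR s x) = bc_scale tR (r * s) x"
    by (induction x rule: R.induct) (simp_all add: bc_scale.diff mult.assoc)
  show "bc_scale tR 1 x = x"
    by (induction x rule: R.induct) (simp_all add: bc_scale.diff)
qed

text \<open>Additivity in the second argument is where characteristic \<open>p\<close> of \<open>R\<close> enters.\<close>

lemma additive_bc_theta: "Modules.additive (bc_theta p t tR)"
  and bc_theta_pure [simp]: "bc_theta p t tR (tR x r) = tR (obar_act t obar_theta x) (r ^ p)"
proof -
  have "tR (obar_act t obar_theta (fbar_scale t c x)) (r ^ p)
      = tR (obar_act t obar_theta x) ((\<eta> c * r) ^ p)" for x c r
    by (simp add: obar_theta_scale R.balanced \<eta>_power power_mult_distrib)
  then show "Modules.additive (bc_theta p t tR)"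
    "bc_theta p t tR (tR x r) = tR (obar_act t obar_theta x) (r ^ p)"
    unfolding bc_theta_def
    by (intro R.tensor_map; simp add: act.add frob_add[where c = 1, simplified] R.add_left R.add_right)+
qed

sublocale bc_theta: Modules.additive "bc_theta p t tR"
  by (rule additive_bc_theta)

definition map_row :: "'k^'n \<Rightarrow> 'r^'n" where
  "map_row m = (\<chi> j. \<eta> (m $ j))"

lemma map_row_nth [simp]: "map_row m $ j = \<eta> (m $ j)"
  by (simp add: map_row_def)

definition bc_level :: "nat \<Rightarrow> 'fr \<Rightarrow> 'r^'n" where
  "bc_level a = tensor_map tR (\<lambda>x r. r *s map_row (level a x)) (\<lambda>x. x) (\<lambda>r. r)"

lemma additive_bc_level: "Modules.additive (bc_level a)"
  and bc_level_pure [simp]: "bc_level a (tR x r) = r *s map_row (level a x)"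
proof -
  let ?\<beta> = "\<lambda>x (r :: 'r). r *s map_row (level a x)"
  have "?\<beta> (x + y) r = ?\<beta> x r + ?\<beta> y r" "?\<beta> x (r + s) = ?\<beta> x r + ?\<beta> x s"
    "?\<beta> (fbar_scale t c x) r = ?\<beta> x (\<eta> c * r)" for x y r s c
    by (simp_all add: vec_eq_iff level.add level_scale \<eta>_add \<eta>_mult algebra_simps)
  from R.tensor_map_bilinear[of ?\<beta>, OF this]
  show "Modules.additive (bc_level a)" "bc_level a (tR x r) = r *s map_row (level a x)"
    unfolding bc_level_def by auto
qed

sublocale bc_level: Modules.additive "bc_level a" for a
  by (rule additive_bc_level)

lemma bc_theta_power_pure: "(bc_theta p t tR ^^ a) (tR x r) = tR (obar_act t (obar_theta ^ a) x) (r ^ (p ^ a))"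
  by (induction a) (simp_all add: obar_act_mult power_mult[symmetric] mult.commute)

lemma bc_theta_power_row:
  "(bc_theta p t tR ^^ a) (row_vec t tR e m) = (\<Sum>j\<in>UNIV. tR (t (obar_theta ^ a) (e j)) (m $ j ^ (p ^ a)))"
proof -
  have "(bc_theta p t tR ^^ a) (x + y) = (bc_theta p t tR ^^ a) x + (bc_theta p t tR ^^ a) y" for x y
    by (induction a) (simp_all add: bc_theta.add)
  then interpret Modules.additive "bc_theta p t tR ^^ a"
    by unfold_locales
  show ?thesis
    unfolding row_vec_def sum by (simp add: bc_theta_power_pure)
qed

lemma row_vec_axis: "(bc_theta p t tR ^^ a) (row_vec t tR e (axis j 1)) = tR (t (obar_theta ^ a) (e j)) 1"
proof -
  have "tR (t (obar_theta ^ a) (e i)) ((axis j 1 :: 'r^'n) $ i ^ (p ^ a))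
      = (if i = j then tR (t (obar_theta ^ a) (e j)) 1 else 0)" for i
    by (simp add: axis_def R.right.zero power_0_left)
  then show ?thesis
    by (simp add: bc_theta_power_row)
qed

text \<open>
  The base change has the level structure: the elements \<open>(\<theta>\<^sup>a \<otimes> e\<^sub>j) \<otimes> 1\<close> span it, and \<open>bc_level\<close>
  gives their coefficients.
\<close>

sublocale theta_module p "bc_scale tR" "bc_theta p t tR" "row_vec t tR e" bc_level
proof
  fix x y :: 'fr and r :: 'r and m m' :: "'r^'n" and a b :: nat
  show "bc_theta p t tR (x + y) = bc_theta p t tR x + bc_theta p t tR y"
    by (rule bc_theta.add)
  show "bc_theta p t tR (bc_scale tR r x) = bc_scale tR (r ^ p) (bc_theta p t tR x)"
    by (induction x rule: R.induct) (simp_all add: bc_scale.diff bc_theta.diff power_mult_distrib)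
  show "row_vec t tR e (m + m') = row_vec t tR e m + row_vec t tR e m'"
    by (simp add: row_vec_def R.add_right sum.distrib)
  show "row_vec t tR e (r *s m) = bc_scale tR r (row_vec t tR e m)"
    by (simp add: row_vec_def bc_scale.sum)
  show "bc_level a (x + y) = bc_level a x + bc_level a y"
    by (rule bc_level.add)
  show "bc_level a (bc_scale tR r x) = r *s bc_level a x"
    by (induction x rule: R.induct)
      (simp_all add: bc_scale.diff bc_level.diff vec_eq_iff algebra_simps)
  show "bc_level b ((bc_theta p t tR ^^ a) (row_vec t tR e m)) = (if a = b then frob_row (p ^ a) m else 0)"
    if "a < CARD('n)"
  proof -
    have "map_row (level b (t (obar_theta ^ a) (e j))) = (if a = b then axis j 1 else 0)" for j
      using that by (auto simp: power_0_left vec_eq_iff obar_nth_theta_power axis_def \<eta>.zero)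
    then have "bc_level b ((bc_theta p t tR ^^ a) (row_vec t tR e m))
        = (\<Sum>j\<in>UNIV. (m $ j ^ (p ^ a)) *s (if a = b then axis j 1 else 0))"
      by (simp add: bc_theta_power_row bc_level.sum del: level_pure)
    also have "\<dots> = (if a = b then frob_row (p ^ a) m else 0)"
      by (cases "a = b") (simp_all add: vec_eq_iff axis_def if_distrib cong: if_cong)
    finally show ?thesis .
  qed
  show "(bc_theta p t tR ^^ CARD('n)) (row_vec t tR e m) = 0"
    by (simp add: bc_theta_power_row left.zero R.left.zero)
  show "x = (\<Sum>a<CARD('n). \<Sum>j\<in>UNIV. bc_scale tR (bc_level a x $ j)
      ((bc_theta p t tR ^^ a) (row_vec t tR e (axis j 1))))"
    unfolding row_vec_axis
  proof (induction x rule: R.induct)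
    case (pure f r)
    have "tR f r = (\<Sum>a<CARD('n). \<Sum>j\<in>UNIV. tR (fbar_scale t (level a f $ j) (t (obar_theta ^ a) (e j))) r)"
      by (subst level_expand) (simp only: R.left.sum)
    also have "\<dots> = (\<Sum>a<CARD('n). \<Sum>j\<in>UNIV. bc_scale tR (bc_level a (tR f r) $ j) (tR (t (obar_theta ^ a) (e j)) 1))"
      by (simp add: R.balanced mult.commute del: fbar_scale_pure)
    finally show ?case .
  next
    case (diff f g)
    then show ?case
      by (simp add: bc_level.diff M.scale_left_diff_distrib sum_subtractf del: bc_scale_pure)
  qed
qed

lemma L_points_eq: "L_points p t tR e = relation_span"
  by (simp add: fun_eq_iff L_points_def relation_span_def)

lemma bc_V_eq: "bc_V t tR = range (row_vec t tR e)"
proof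
  have "tR (t 1 v) 1 = row_vec t tR e (map_row (coord v))" for v
  proof -
    have "tR (t 1 v) 1 = tR (\<Sum>j\<in>UNIV. fbar_scale t (coord v $ j) (t 1 (e j))) 1"
      by (simp only: fbar_scale_V sum_coord flip: right.sum)
    then show ?thesis
      by (simp add: R.left.sum R.balanced row_vec_def del: fbar_scale_pure)
  qed
  moreover have "M.subspace (range (row_vec t tR e))"
    unfolding M.subspace_def by (metis (no_types, lifting) emb.zero emb_add emb_scale rangeE rangeI)
  ultimately show "bc_V t tR \<subseteq> range (row_vec t tR e)"
    unfolding bc_V_def by (intro M.span_minimal) auto
  show "range (row_vec t tR e) \<subseteq> bc_V t tR"
  proof clarify
    fix m :: "'r^'n"
    have "row_vec t tR e m = (\<Sum>j\<in>UNIV. bc_scale tR (m $ j) (tR (t 1 (e j)) 1))"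
      by (simp add: row_vec_def)
    also have "\<dots> \<in> bc_V t tR"
      unfolding bc_V_def by (intro M.span_sum M.span_scale M.span_base) auto
    finally show "row_vec t tR e m \<in> bc_V t tR" .
  qed
qed

lemma bij_betw_L_points: "bij_betw (L_points p t tR e) (nilp_points p) (Y0_points p t tR)"
  unfolding bij_betw_def L_points_eq
proof
  show "inj_on relation_span (nilp_points p)"
    by (rule inj_on_relation_span)
  show "relation_span ` nilp_points p = Y0_points p t tR"
  proof (intro equalityI subsetI)
    fix L assume "L \<in> relation_span ` nilp_points p"
    then obtain B where B: "B \<in> nilp_points p" and L: "L = relation_span B"
      by blast
    show "L \<in> Y0_points p t tR"
      using relation_span_stable[OF B] relation_span_Int_emb[OF B] relation_span_complement[OF B]
        complement_locally_free[OF subspace_relation_span relation_span_Int_emb[OF B] relation_span_complement[OF B]]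
      by (simp add: L Y0_points_def Y_points_def grass_points_def bc_V_eq subspace_relation_span)
  next
    fix L assume "L \<in> Y0_points p t tR"
    then have "M.subspace L" "bc_theta p t tR ` L \<subseteq> L" "L \<inter> range (row_vec t tR e) = {0}"
      "\<And>x. \<exists>y\<in>L. \<exists>v\<in>range (row_vec t tR e). x = y + v"
      unfolding Y0_points_def Y_points_def grass_points_def bc_V_eq by auto
    then show "L \<in> relation_span ` nilp_points p"
      by (rule complement_is_relation_span) auto
  qed
qed

end


section \<open>Naturality in the algebra\<close>

lemma frob_mat_map_matrix:
  assumes "is_ring_hom f"
  shows "frob_mat q (map_matrix f A) = map_matrix f (frob_mat q A)"
proof -
  have "f (x ^ i) = f x ^ i" for x i
    using assms by (induction i) (auto simp: is_ring_hom_def)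
  then show ?thesis by (simp add: vec_eq_iff)
qed

lemma map_matrix_times:
  fixes A :: "'a::comm_ring_1^'n::finite^'m::finite"
  assumes "is_ring_hom f"
  shows "map_matrix f (A ** B) = map_matrix f A ** map_matrix f B"
proof -
  interpret Modules.additive f
    by standard (use assms in \<open>simp add: is_ring_hom_def\<close>)
  show ?thesis
    using assms by (simp add: vec_eq_iff matrix_matrix_mult_def sum is_ring_hom_def)
qed

lemma map_matrix_one:
  assumes "is_ring_hom f"
  shows "map_matrix f (mat 1) = mat 1"
proof -
  interpret Modules.additive f
    by standard (use assms in \<open>simp add: is_ring_hom_def\<close>)
  show ?thesis
    using assms by (simp add: vec_eq_iff mat_def zero is_ring_hom_def)
qed

lemma frob_prod_map_matrix:
  assumes "is_ring_hom f"
  shows "frob_prod p (map_matrix f B) c = map_matrix f (frob_prod p B c)"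
  by (induction c) (simp_all add: assms map_matrix_one frob_mat_map_matrix map_matrix_times)

context fbar
begin

text \<open>
  The pullback map \<open>T\<close> intertwines \<open>proj B\<close> with \<open>proj (f B)\<close>, which gives one inclusion.  For the other,
  the generators \<open>\<theta>\<^sup>a \<otimes> e\<^sub>j - 1 \<otimes> \<phi>\<^sup>a(e\<^sub>j)\<close> over \<open>S\<close> are images under \<open>T\<close> of those over \<open>R\<close>.
\<close>

lemma pullback_L_points:
  fixes \<eta> :: "'k \<Rightarrow> 'r::comm_ring_1" and tR :: "'f \<Rightarrow> 'r \<Rightarrow> 'fr::ab_group_add"
    and \<eta>' :: "'k \<Rightarrow> 's::comm_ring_1" and tS :: "'f \<Rightarrow> 's \<Rightarrow> 'fs::ab_group_add"
  assumes R: "base_change t \<eta> tR" and S: "base_change t \<eta>' tS"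
    and f: "is_ring_hom f" "f \<circ> \<eta> = \<eta>'" and B: "B \<in> nilp_points p"
  shows "map_matrix f B \<in> nilp_points p"
    and "L_points p t tS e (map_matrix f B) = pullback_sub tR tS f (L_points p t tR e B)"
proof -
  interpret R: fbar_base_change scaleV t p e \<eta> tR by standard (rule R)
  interpret S: fbar_base_change scaleV t p e \<eta>' tS by standard (rule S)
  interpret f: Modules.additive f
    by standard (use f in \<open>simp add: is_ring_hom_def\<close>)
  have f_1: "f 1 = 1" and f_mult: "f (x * y) = f x * f y" for x y
    using f(1) by (auto simp: is_ring_hom_def)
  have f_\<eta>: "f (\<eta> c) = \<eta>' c" for c
    using f(2) by auto
  let ?B = "map_matrix f B"
  have frob: "frob_prod p ?B c = map_matrix f (frob_prod p B c)" for c
    by (rule frob_prod_map_matrix) (rule f)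
  have frob_row_eq: "frob_prod p ?B c $ j = (\<chi> i. f (frob_prod p B c $ j $ i))" for c j
    by (simp add: frob vec_eq_iff)
  show B': "?B \<in> nilp_points p"
    using B by (simp add: nilp_points_def frob) (simp add: vec_eq_iff f.zero)
  let ?T = "tensor_map tR tS (\<lambda>x. x) f"
  have "tS (fbar_scale t c x) (f r) = tS x (f (\<eta> c * r))" for c x r
    by (simp add: S.R.balanced f_mult f_\<eta>)
  then have "Modules.additive ?T" and T_pure: "?T (tR x r) = tS x (f r)" for x r
    by (intro R.R.tensor_map; simp add: S.R.add_left S.R.add_right f.add)+
  interpret T: Modules.additive ?T by fact
  have T_level: "S.bc_level a (?T x) = (\<chi> j. f (R.bc_level a x $ j))" for a x
    by (induction x rule: R.R.induct)
      (simp_all add: R.bc_level.diff S.bc_level.diff T.diff T_pure f_mult f_\<eta> vec_eq_iff f.diff)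
  have T_proj: "S.proj ?B (?T x) = (\<chi> j. f (R.proj B x $ j))" for x
    by (simp add: R.proj_def S.proj_def T_level frob vec_eq_iff vector_matrix_mult_def f.sum f_mult)
  have T_e: "?T ((bc_theta p t tR ^^ a) (row_vec t tR e (axis j 1)))
      = (bc_theta p t tS ^^ a) (row_vec t tS e (axis j 1))" for a j
    by (simp add: R.row_vec_axis S.row_vec_axis T_pure f_1)
  have T_row: "?T (row_vec t tR e m) = row_vec t tS e (\<chi> j. f (m $ j))" for m
    by (simp add: row_vec_def T.sum T_pure)
  show "L_points p t tS e ?B = pullback_sub tR tS f (L_points p t tR e B)"
    unfolding R.L_points_eq S.L_points_eq
  proof
    show "S.relation_span ?B \<subseteq> pullback_sub tR tS f (R.relation_span B)"
    proof
      fix y assume "y \<in> S.relation_span ?B"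
      then have "y = y - row_vec t tS e (S.proj ?B y)"
        by (simp add: S.relation_span_eq_kernel[OF B'] S.emb.zero)
      also have "\<dots> = (\<Sum>a<CARD('n). \<Sum>j\<in>UNIV. bc_scale tS (S.bc_level a y $ j)
          (?T ((bc_theta p t tR ^^ a) (row_vec t tR e (axis j 1))
             - row_vec t tR e ((row_map p B ^^ a) (axis j 1)))))"
        unfolding S.expand_minus_proj[OF B'] T.diff T_e T_row R.row_map_power_axis S.row_map_power_axis
        by (simp only: frob_row_eq)
      also have "\<dots> \<in> pullback_sub tR tS f (R.relation_span B)"
        unfolding pullback_sub_def
        by (intro S.M.span_sum S.M.span_scale S.M.span_base imageI R.level_cong_relation_span)
      finally show "y \<in> pullback_sub tR tS f (R.relation_span B)" .
    qed
    show "pullback_sub tR tS f (R.relation_span B) \<subseteq> S.relation_span ?B"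
      unfolding pullback_sub_def
    proof (rule S.M.span_minimal)
      show "?T ` R.relation_span B \<subseteq> S.relation_span ?B"
        by (auto simp: R.relation_span_eq_kernel[OF B] S.relation_span_eq_kernel[OF B'] T_proj vec_eq_iff f.zero)
    qed (rule S.subspace_relation_span)
  qed
qed

end

section \<open>Equivariance\<close>

context fbar
begin

text \<open>The explicit form of the unique map that the definite description in \<open>mat_right\<close> picks out.\<close>

lemma mat_right_eq: "mat_right scaleV e C v = (\<Sum>j\<in>UNIV. scaleV ((coord v v* C) $ j) (e j))"
proof -
  let ?g = "\<lambda>v. \<Sum>j\<in>UNIV. scaleV ((coord v v* C) $ j) (e j)"
  have "Vector_Spaces.linear scaleV scaleV ?g"
    by unfold_locales (simp_all add: coord_add coord_scale vector_matrix_left_distrib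
        scalar_vector_matrix V.scale_left_distrib sum.distrib V.scale_sum_right)
  moreover have "has_matrix scaleV e ?g C"
    by (simp add: has_matrix_def)
  moreover have "g = ?g" if g: "Vector_Spaces.linear scaleV scaleV g" "has_matrix scaleV e g C" for g
  proof
    interpret g: Vector_Spaces.linear scaleV scaleV g by (rule g)
    fix v
    have "g v = (\<Sum>i\<in>UNIV. scaleV (coord v $ i) (\<Sum>j\<in>UNIV. scaleV (C $ i $ j) (e j)))"
      using g(2) by (subst sum_coord[of v, symmetric]) (simp add: g.sum g.scale has_matrix_def)
    also have "\<dots> = (\<Sum>j\<in>UNIV. \<Sum>i\<in>UNIV. scaleV (coord v $ i * C $ i $ j) (e j))"
      by (simp add: V.scale_sum_right) (rule sum.swap)
    also have "\<dots> = ?g v"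
      by (simp add: vector_matrix_mult_def V.scale_sum_left)
    finally show "g v = ?g v" .
  qed
  ultimately have "mat_right scaleV e C = ?g"
    unfolding mat_right_def by (intro the_equality) blast+
  then show ?thesis by simp
qed

lemma coord_mat_right [simp]: "coord (mat_right scaleV e C v) = coord v v* C"
  by (simp add: mat_right_eq)

lemma mat_right_add: "mat_right scaleV e C (v + w) = mat_right scaleV e C v + mat_right scaleV e C w"
  by (rule coord_inj) (simp add: coord_add vector_matrix_left_distrib)

lemma mat_right_scale: "mat_right scaleV e C (scaleV c v) = scaleV c (mat_right scaleV e C v)"
  by (rule coord_inj) (simp add: coord_scale scalar_vector_matrix)

lemma additive_fbar_mat_right: "Modules.additive (fbar_mat_right t scaleV e C)"
  and fbar_mat_right_pure [simp]: "fbar_mat_right t scaleV e C (t x v) = t x (mat_right scaleV e C v)"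
proof -
  have "t (obar_ract x c) (mat_right scaleV e C v) = t x (mat_right scaleV e C (scaleV c v))" for x c v
    by (simp add: mat_right_scale balanced)
  then show "Modules.additive (fbar_mat_right t scaleV e C)"
    "fbar_mat_right t scaleV e C (t x v) = t x (mat_right scaleV e C v)"
    unfolding fbar_mat_right_def by (intro tensor_map; simp add: add_left add_right mat_right_add)+
qed

sublocale mr: Modules.additive "fbar_mat_right t scaleV e C" for C
  by (rule additive_fbar_mat_right)

lemma fbar_mat_right_scale:
  "fbar_mat_right t scaleV e C (fbar_scale t c x) = fbar_scale t c (fbar_mat_right t scaleV e C x)"
  by (induction x rule: induct) (simp_all add: mr.diff F.scale_right_diff_distrib)

lemma level_mat_right:
  "level a (fbar_mat_right t scaleV e C x) = level a x v* frob_mat (p ^ a) C"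
  by (induction x rule: induct)
    (simp_all add: mr.diff level.diff k.frob_row_times scalar_vector_matrix vector_matrix_mult_diff_distrib)

end

context fbar_base_change
begin

lemma \<eta>_ring_hom: "is_ring_hom \<eta>"
  using bc by (simp add: base_change_def)

definition bc_mat_right :: "'k^'n^'n \<Rightarrow> 'fr \<Rightarrow> 'fr" where
  "bc_mat_right C = tensor_map tR tR (fbar_mat_right t scaleV e C) (\<lambda>r. r)"

lemma additive_bc_mat_right: "Modules.additive (bc_mat_right C)"
  and bc_mat_right_pure [simp]: "bc_mat_right C (tR x r) = tR (fbar_mat_right t scaleV e C x) r"
proof -
  have "tR (fbar_mat_right t scaleV e C (fbar_scale t c x)) r = tR (fbar_mat_right t scaleV e C x) (\<eta> c * r)" for x c r
    by (simp add: fbar_mat_right_scale R.balanced)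
  then show "Modules.additive (bc_mat_right C)"
    "bc_mat_right C (tR x r) = tR (fbar_mat_right t scaleV e C x) r"
    unfolding bc_mat_right_def by (intro R.tensor_map; simp add: R.add_left R.add_right mr.add)+
qed

sublocale bmr: Modules.additive "bc_mat_right C" for C
  by (rule additive_bc_mat_right)

text \<open>Moving the entries of \<open>C\<close> to the left past \<open>\<theta>\<^sup>a\<close> twists them by \<open>p\<^sup>a\<close>.\<close>

lemma bc_level_mat_right:
  "bc_level a (bc_mat_right C x) = bc_level a x v* frob_mat (p ^ a) (map_matrix \<eta> C)"
proof (induction x rule: R.induct)
  case (pure x r)
  show ?case
    by (simp add: level_mat_right vec_eq_iff vector_matrix_mult_def \<eta>.sum \<eta>_mult \<eta>_power
        sum_distrib_left mult.assoc)
qed (simp_all add: bmr.diff bc_level.diff vector_matrix_mult_diff_distrib)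

lemma bc_level_eqI:
  assumes "\<And>a. bc_level a x = bc_level a y"
  shows "x = y"
  by (subst expand[of x], subst expand[of y]) (simp only: assms)

lemma frob_mat_inverse:
  fixes A C :: "'r^'n^'n"
  assumes "A ** C = mat 1"
  shows "frob_mat (p ^ c) A ** frob_mat (p ^ c) C = mat 1"
proof -
  have "frob_mat (p ^ c) (mat 1 :: 'r^'n^'n) = mat 1"
    by (simp add: vec_eq_iff mat_def power_0_left)
  then show ?thesis
    by (simp add: assms flip: frob_mat_times)
qed

text \<open>
  Write \<open>C = A\<^bsup>-1\<^esup>\<close> and \<open>B' = A\<^bsup>[p]\<^esup> B C\<close>.  The inner factors telescope, so that \<open>P'\<^sub>a = A\<^bsup>[p^a]\<^esup> P\<^sub>a C\<close>.  Right
  multiplication by \<open>C\<close> acts on level \<open>a\<close> by \<open>C\<^bsup>[p^a]\<^esup>\<close>, which cancels the first factor and gives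
  \<open>proj B' (x C) = (proj B x) C\<close>.  Both right multiplications by \<open>C\<close> are invertible, so the kernels correspond.
\<close>

lemma L_points_equivariant:
  fixes A :: "'k^'n^'n"
  assumes A: "invertible A" and B: "B \<in> nilp_points p"
  shows "gl_act_mat p \<eta> A B \<in> nilp_points p"
    and "L_points p t tR e (gl_act_mat p \<eta> A B) = gl_act_sub t scaleV e tR A (L_points p t tR e B)"
proof -
  define C where "C = matrix_inv A"
  have "\<exists>C. A ** C = mat 1 \<and> C ** A = mat 1"
    using A by (auto simp: invertible_def)
  then have "A ** C = mat 1 \<and> C ** A = mat 1"
    unfolding C_def matrix_inv_def by (rule someI_ex)
  then have AC: "map_matrix \<eta> A ** map_matrix \<eta> C = mat 1" "map_matrix \<eta> C ** map_matrix \<eta> A = mat 1"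
    by (simp_all add: map_matrix_one[OF \<eta>_ring_hom] flip: map_matrix_times[OF \<eta>_ring_hom])
  let ?A = "map_matrix \<eta> A" and ?C = "map_matrix \<eta> C"
  define B' where "B' = gl_act_mat p \<eta> A B"
  have B'_eq: "B' = frob_mat p ?A ** B ** ?C"
    by (simp add: B'_def gl_act_mat_def C_def frob_mat_map_matrix[OF \<eta>_ring_hom])
  have frob: "frob_prod p B' c = frob_mat (p ^ c) ?A ** frob_prod p B c ** ?C" for c
  proof (induction c)
    case 0
    have "frob_mat (Suc 0) ?A = ?A" by (simp add: vec_eq_iff)
    with AC show ?case by simp
  next
    case (Suc c)
    have "frob_mat (p ^ c) (frob_mat p ?A) = frob_mat (p ^ Suc c) ?A"
      by (simp add: vec_eq_iff power_mult)
    then have twist: "frob_mat (p ^ c) B' = frob_mat (p ^ Suc c) ?A ** frob_mat (p ^ c) B ** frob_mat (p ^ c) ?C"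
      by (simp only: B'_eq frob_mat_times)
    have "frob_prod p B' (Suc c) = frob_mat (p ^ Suc c) ?A ** frob_mat (p ^ c) B **
        (frob_mat (p ^ c) ?C ** frob_mat (p ^ c) ?A) ** frob_prod p B c ** ?C"
      by (simp only: frob_prod.simps(2) twist Suc matrix_mul_assoc)
    then show ?case
      by (simp add: frob_mat_inverse[OF AC(2)] matrix_mul_assoc)
  qed
  show B': "gl_act_mat p \<eta> A B \<in> nilp_points p"
    using B frob[of "CARD('n)"] by (simp add: nilp_points_def flip: B'_def)
  have proj: "proj B' (bc_mat_right C x) = proj B x v* ?C" for x
  proof -
    have times_inverse: "bc_level a x v* frob_mat (p ^ a) ?C v* (frob_mat (p ^ a) ?A ** frob_prod p B a ** ?C)
        = bc_level a x v* frob_prod p B a v* ?C" for a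
      by (simp add: vector_matrix_mul_assoc matrix_mul_assoc frob_mat_inverse[OF AC(2)])
    have "Modules.additive (\<lambda>y :: 'r^'n. y v* ?C)"
      by standard (rule vector_matrix_left_distrib)
    note times_C_sum = Modules.additive.sum[OF this]
    show ?thesis
      by (simp add: proj_def bc_level_mat_right frob times_inverse times_C_sum)
  qed
  have inverse: "bc_mat_right C (bc_mat_right A y) = y" for y
    by (rule bc_level_eqI)
      (simp add: bc_level_mat_right vector_matrix_mul_assoc frob_mat_inverse[OF AC(1)])
  have C_inj: "m = 0" if "m v* ?C = 0" for m
  proof -
    have "m v* ?C v* ?A = 0" using that by simp
    then show ?thesis by (simp add: vector_matrix_mul_assoc AC)
  qed
  have "{x. proj B' x = 0} = bc_mat_right C ` {x. proj B x = 0}"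
  proof (intro equalityI subsetI)
    fix y assume "y \<in> {x. proj B' x = 0}"
    then have "proj B (bc_mat_right A y) v* ?C = 0"
      using proj[of "bc_mat_right A y"] inverse[of y] by simp
    then have "proj B (bc_mat_right A y) = 0" by (rule C_inj)
    then show "y \<in> bc_mat_right C ` {x. proj B x = 0}"
      by (intro image_eqI[of _ _ "bc_mat_right A y"]) (simp_all add: inverse)
  qed (auto simp: proj)
  then show "L_points p t tR e (gl_act_mat p \<eta> A B) = gl_act_sub t scaleV e tR A (L_points p t tR e B)"
    using B' unfolding L_points_eq gl_act_sub_def bc_mat_right_def[symmetric] C_def[symmetric] B'_def[symmetric]
    by (simp add: relation_span_eq_kernel B)
qed

end


section \<open>The correspondence over the base field\<close>

context fbar
begin

text \<open>
  \<open>M \<otimes>\<^sub>k k = M\<close>.  Modulo the relations, every element \<open>u\<close> of the free abelian group equals the generator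
  \<open>(x, 1)\<close>, where \<open>x\<close> is the image of \<open>u\<close> in \<open>M\<close>; so \<open>u\<close> is a relation as soon as \<open>x = 0\<close>.
\<close>

lemma base_change_self: "base_change t (\<lambda>c. c) (\<lambda>x c. fbar_scale t c x)"
proof -
  let ?rels = "tensor_rels (\<lambda>x c. fbar_scale t c x) (\<lambda>c r. c * r)"
  let ?h = "frag_sum (\<lambda>(x, c). fbar_scale t c x)"
  interpret h: Modules.additive ?h by (rule additive_frag_sum)
  have rel_0: "?h u = 0" if "u \<in> ?rels" for u
    using that by induction (simp_all add: h.zero h.diff F.scale_right_distrib F.scale_left_distrib mult.commute)
  have add: "u + w \<in> ?rels" if "u \<in> ?rels" "w \<in> ?rels" for u w
    using tensor_rels.diff[OF that(1) tensor_rels.diff[OF tensor_rels.zero that(2)]] by simp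
  have red: "u - frag_of (?h u, 1) \<in> ?rels" for u
  proof (induction u rule: frag_induct)
    case (of xc)
    obtain x c where xc: "xc = (x, c)" by fastforce
    have "frag_of (fbar_scale t c x, 1) - frag_of (x, c * 1) \<in> ?rels"
      by (rule tensor_rels.balanced)
    from tensor_rels.diff[OF tensor_rels.zero this] show ?case by (simp add: xc)
  next
    case (diff u w)
    have "frag_of (?h (u - w) + ?h w, 1) - frag_of (?h (u - w), 1) - frag_of (?h w, 1) \<in> ?rels"
      by (rule tensor_rels.add_left)
    then have "frag_of (?h u, 1) - frag_of (?h (u - w), 1) - frag_of (?h w, 1) \<in> ?rels"
      by (simp add: h.diff)
    from add[OF tensor_rels.diff[OF diff] this] show ?case
      by (simp add: algebra_simps)
  qed
  have zero: "frag_of (0, 1) \<in> ?rels"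
    using tensor_rels.diff[OF tensor_rels.zero, OF tensor_rels.add_left[of 0 0 1]] by simp
  have "?h -` {0} = ?rels"
  proof (intro equalityI subsetI)
    fix u assume "u \<in> ?h -` {0}"
    with add[OF red[of u] zero] show "u \<in> ?rels" by simp
  qed (simp add: rel_0)
  note ker = this
  have surj: "surj ?h"
    by (rule surjI[of _ "\<lambda>x. frag_of (x, 1)"]) simp
  have "tensor_product (\<lambda>x c. fbar_scale t c x) (\<lambda>c r. c * r) (\<lambda>x c. fbar_scale t c x)"
    unfolding tensor_product_def by (intro exI[of _ ?h] conjI allI h.additive_axioms surj ker) simp
  then show ?thesis
    by (simp add: base_change_def is_ring_hom_def)
qed

text \<open>The truncated Ore ring is generated by the scalars and \<open>\<theta>\<close>.\<close>

lemma left_submodule_iff: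
  "left_submodule (obar_act t) L \<longleftrightarrow> F.subspace L \<and> obar_act t obar_theta ` L \<subseteq> L"
proof
  assume "left_submodule (obar_act t) L"
  then show "F.subspace L \<and> obar_act t obar_theta ` L \<subseteq> L"
    by (auto simp: left_submodule_def F.subspace_def fbar_scale_def)
next
  assume L: "F.subspace L \<and> obar_act t obar_theta ` L \<subseteq> L"
  have power: "obar_act t (obar_theta ^ a) x \<in> L" if "x \<in> L" for a x
    using that L by (induction a) (auto simp: obar_act_mult)
  have "obar_act t y x \<in> L" if "x \<in> L" for x y
  proof -
    have "obar_act t y x = (\<Sum>a<CARD('n). fbar_scale t (obar_nth y a) (obar_act t (obar_theta ^ a) x))"
      by (subst obar_expand) (simp add: obar_act_sum obar_act_mult fbar_scale_def)
    then show ?thesis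
      using L power[OF that] by (simp add: F.subspace_sum F.subspace_scale)
  qed
  with L show "left_submodule (obar_act t) L"
    by (auto simp: left_submodule_def F.subspace_def)
qed

text \<open>Since \<open>V\<close> has dimension \<open>n\<close> and \<open>L \<inter> V = 0\<close>, the sum \<open>L + V\<close> has dimension \<open>dim L + n\<close>.\<close>

lemma has_codim_iff_complement:
  assumes L: "F.subspace L" and trans: "transversal_V t L"
  shows "has_codim (fbar_scale t) L CARD('n) \<longleftrightarrow> (\<forall>x. \<exists>y\<in>L. \<exists>v\<in>range (t 1). x = y + v)"
proof -
  let ?G = "(\<lambda>(a, j). t (obar_theta ^ a) (e j)) ` ({..<CARD('n)} \<times> UNIV)"
  \<comment> \<open>The theory of dimension is available once some finite basis of the whole module is fixed.\<close>
  obtain Bs where Bs: "Bs \<subseteq> ?G" "F.independent Bs" "?G \<subseteq> F.span Bs"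
    using F.maximal_independent_subset[of ?G] by metis
  have "x \<in> F.span Bs" for x
    unfolding arg_cong[OF level_expand[of x], of "\<lambda>x. x \<in> F.span Bs"]
    using Bs(3) by (intro F.span_sum F.span_scale) auto
  then interpret fd: finite_dimensional_vector_space "fbar_scale t" Bs
    using Bs finite_subset[OF Bs(1)] by unfold_locales auto
  interpret t1: Vector_Spaces.linear scaleV "fbar_scale t" "t 1"
    by unfold_locales (simp_all only: right.add fbar_scale_V)
  have inj_t1: "inj (t 1)"
  proof
    fix v w assume "t 1 v = t 1 w"
    then have "level 0 (t 1 v) = level 0 (t 1 w)" by simp
    then show "v = w" by (intro coord_inj) simp
  qed
  have V: "F.subspace (range (t 1))"
    using t1.subspace_image[OF V.subspace_UNIV] .
  have "F.dim (range (t 1)) = card (t 1 ` range e)"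
  proof (rule F.dim_eq_card)
    show "F.span (t 1 ` range e) = F.span (range (t 1))"
      using V by (metis t1.span_image span F.span_eq_iff)
    show "F.independent (t 1 ` range e)"
      using inj_t1 by (intro t1.independent_injective_image independent) (simp add: span)
  qed
  also have "\<dots> = CARD('n)"
    using inj_t1 inj by (simp add: card_image inj_on_subset)
  finally have dim_V: "F.dim (range (t 1)) = CARD('n)" .
  let ?S = "{x + y |x y. x \<in> L \<and> y \<in> range (t 1)}"
  have "F.dim (L \<inter> range (t 1)) = 0"
    using trans by (simp add: transversal_V_def)
  then have dim_S: "F.dim ?S = F.dim L + CARD('n)"
    using fd.dim_sums_Int[OF L V] unfolding dim_V by linarith
  have "has_codim (fbar_scale t) L CARD('n) \<longleftrightarrow> F.dim ?S = F.dim UNIV"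
    unfolding has_codim_def dim_S using L by blast
  also have "\<dots> \<longleftrightarrow> ?S = UNIV"
  proof
    assume "F.dim ?S = F.dim UNIV"
    then show "?S = UNIV"
      by (intro fd.subspace_dim_equal[OF F.subspace_sums[OF L V] F.subspace_UNIV]) simp_all
  next
    assume S: "?S = UNIV"
    show "F.dim ?S = F.dim UNIV" by (simp only: S)
  qed
  also have "\<dots> \<longleftrightarrow> (\<forall>x. \<exists>y\<in>L. \<exists>v\<in>range (t 1). x = y + v)"
    unfolding set_eq_iff by blast
  finally show ?thesis .
qed

lemma coord_p_linear:
  assumes "p_linear p scaleV \<phi>" "has_matrix scaleV e \<phi> B"
  shows "coord (\<phi> v) = row_map p B (coord v)"
proof -
  interpret \<phi>: Modules.additive \<phi>
    using assms by (simp add: p_linear_def)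
  have coord_\<phi>: "coord (\<phi> (e i)) = B $ i" for i
    using assms(2) by (simp add: has_matrix_def)
  have "coord (\<phi> v) = coord (\<phi> (\<Sum>i\<in>UNIV. scaleV (coord v $ i) (e i)))"
    by (simp only: sum_coord)
  also have "\<dots> = (\<Sum>i\<in>UNIV. (coord v $ i ^ p) *s (B $ i))"
    using assms(1) by (simp add: \<phi>.sum p_linear_def coord.sum coord_scale coord_\<phi>)
  also have "\<dots> = row_map p B (coord v)"
    by (simp add: row_map_eq vec_eq_iff vector_matrix_mult_def)
  finally show ?thesis .
qed

lemma coord_p_linear_power:
  assumes "p_linear p scaleV \<phi>" "has_matrix scaleV e \<phi> B"
  shows "coord ((\<phi> ^^ c) v) = (row_map p B ^^ c) (coord v)"
  by (induction c) (simp_all add: coord_p_linear[OF assms])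

lemma p_linear_has_matrix:
  "has_matrix scaleV e \<phi> (\<chi> i. coord (\<phi> (e i)))"
  by (simp add: has_matrix_def sum_coord)

lemma ex_p_linear_of_matrix:
  obtains \<phi> where "p_linear p scaleV \<phi>" "has_matrix scaleV e \<phi> B"
proof
  let ?\<phi> = "\<lambda>v. \<Sum>j\<in>UNIV. scaleV (row_map p B (coord v) $ j) (e j)"
  show "p_linear p scaleV ?\<phi>"
    unfolding p_linear_def
  proof (intro conjI allI)
    show "Modules.additive ?\<phi>"
      by standard (simp add: coord_add k.row_map_add V.scale_left_distrib sum.distrib)
    show "?\<phi> (scaleV a v) = scaleV (a ^ p) (?\<phi> v)" for a v
      by (simp add: coord_scale k.row_map_scale V.scale_sum_right)
  qed
  show "has_matrix scaleV e ?\<phi> B"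
    by (simp add: has_matrix_def row_map_eq)
qed

lemma p_linear_eqI:
  assumes "p_linear p scaleV \<phi>" "p_linear p scaleV \<psi>" "has_matrix scaleV e \<phi> B" "has_matrix scaleV e \<psi> B"
  shows "\<phi> = \<psi>"
  using coord_p_linear[OF assms(1,3)] coord_p_linear[OF assms(2,4)] by (metis coord_inj ext)

text \<open>
  The kernels of the iterates are \<open>k\<close>-subspaces although the iterates are not linear.  Once two
  consecutive kernels agree, all later ones do; so before they reach \<open>V\<close> the dimension grows by at
  least one at each step, and \<open>n\<close> steps suffice.
\<close>

lemma p_nilpotent_vanishes:
  assumes "p_nilpotent p scaleV \<phi>"
  shows "(\<phi> ^^ CARD('n)) v = 0"
proof -
  interpret fd: finite_dimensional_vector_space scaleV "range e"
    by unfold_locales (auto simp: independent span)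
  interpret \<phi>: Modules.additive \<phi>
    using assms by (simp add: p_nilpotent_def p_linear_def)
  have \<phi>_scale: "\<phi> (scaleV a v) = scaleV (a ^ p) (\<phi> v)" for a v
    using assms by (simp add: p_nilpotent_def p_linear_def)
  let ?K = "\<lambda>i. {v. (\<phi> ^^ i) v = 0}"
  have "(\<phi> ^^ i) 0 = 0" "(\<phi> ^^ i) (v + w) = (\<phi> ^^ i) v + (\<phi> ^^ i) w"
    "(\<phi> ^^ i) (scaleV a v) = scaleV (a ^ (p ^ i)) ((\<phi> ^^ i) v)" for i v w a
    by (induction i) (simp_all add: \<phi>.zero \<phi>.add \<phi>_scale power_mult[symmetric] mult.commute)
  note iter = this
  have sub: "V.subspace (?K i)" for i
    by (auto simp: V.subspace_def iter)
  then have span_K: "V.span (?K i) = ?K i" for i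
    by (simp only: V.span_eq_iff)
  have mono: "?K i \<subseteq> ?K (Suc i)" for i
    by (auto simp: \<phi>.zero)
  have stable: "?K (i + d) = ?K i" if "?K (Suc i) = ?K i" for i d
  proof (induction d)
    case (Suc d)
    have "v \<in> ?K (i + Suc d) \<longleftrightarrow> (\<phi> ^^ d) v \<in> ?K (Suc i)" for v
      by (simp add: funpow_add funpow_swap1 flip: add_Suc)
    moreover have "v \<in> ?K (i + d) \<longleftrightarrow> (\<phi> ^^ d) v \<in> ?K i" for v
      by (simp add: funpow_add)
    ultimately show ?case
      using that Suc by blast
  qed simp
  obtain m where m: "?K m = UNIV"
    using assms by (auto simp: p_nilpotent_def)
  have grow: "i \<le> V.dim (?K i) \<or> ?K i = UNIV" for i
  proof (induction i)
    case (Suc i)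
    show ?case
    proof (cases "?K (Suc i) = ?K i")
      case True
      have "UNIV = ?K m" by (simp only: m)
      also have "?K m \<subseteq> ?K (i + m)"
        by (auto simp: funpow_add iter)
      also have "?K (i + m) = ?K i" by (rule stable) (rule True)
      finally show ?thesis using True by blast
    next
      case False
      with mono[of i] have "?K i \<subset> ?K (Suc i)"
        by blast
      then have "V.dim (?K i) < V.dim (?K (Suc i))"
        by (intro fd.dim_psubset) (simp only: span_K)
      moreover have "?K i \<noteq> UNIV"
        using False mono[of i] by blast
      ultimately show ?thesis using Suc by linarith
    qed
  qed simp
  have "V.dim UNIV = CARD('n)"
    using V.dim_eq_card[of "range e" UNIV] independent inj by (simp add: span card_image)
  then have "CARD('n) \<le> V.dim (?K CARD('n)) \<longrightarrow> ?K CARD('n) = UNIV"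
    using fd.subspace_dim_equal[OF sub V.subspace_UNIV] by simp
  with grow[of "CARD('n)"] show ?thesis by blast
qed

lemma p_nilpotent_iff_nilp_point:
  assumes "p_linear p scaleV \<phi>" "has_matrix scaleV e \<phi> B"
  shows "p_nilpotent p scaleV \<phi> \<longleftrightarrow> B \<in> nilp_points p"
proof -
  have "(\<phi> ^^ c) v = 0 \<longleftrightarrow> (row_map p B ^^ c) (coord v) = 0" for c v
    using coord_p_linear_power[OF assms, of c v] coord_inj[of "(\<phi> ^^ c) v" 0] by (auto simp: coord.zero)
  then have "(\<forall>v. (\<phi> ^^ CARD('n)) v = 0) \<longleftrightarrow> B \<in> nilp_points p"
    unfolding k.nilp_points_iff by (metis coord_sum)
  then show ?thesis
    using p_nilpotent_vanishes assms(1) by (metis p_nilpotent_def)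
qed

sublocale self: fbar_base_change scaleV t p e "\<lambda>c. c" "\<lambda>x c. fbar_scale t c x"
  by standard (rule base_change_self)

lemma bc_scale_self: "bc_scale (\<lambda>x c. fbar_scale t c x) = fbar_scale t"
proof
  fix c
  have "bc_scale (\<lambda>x c. fbar_scale t c x) c x = fbar_scale t c x" for x
    using self.bc_scale_pure[where r = c and x = x and s = 1]
    by (simp only: F.scale_one mult_1_right)
  then show "bc_scale (\<lambda>x c. fbar_scale t c x) c = fbar_scale t c" by blast
qed

lemma bc_theta_self: "bc_theta p t (\<lambda>x c. fbar_scale t c x) x = obar_act t obar_theta x"
  using self.bc_theta_pure[where x = x and r = 1]
  by (simp only: F.scale_one power_one)

lemma row_vec_self: "row_vec t (\<lambda>x c. fbar_scale t c x) e (coord v) = t 1 v"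
  by (simp only: row_vec_def fbar_scale_V sum_coord flip: right.sum)

lemma range_row_vec_self: "range (row_vec t (\<lambda>x c. fbar_scale t c x) e) = range (t 1)"
proof -
  let ?row = "row_vec t (\<lambda>x c. fbar_scale t c x) e"
  have "range coord = UNIV"
    by (rule surjI[where f = "\<lambda>m. \<Sum>j\<in>UNIV. scaleV (m $ j) (e j)"]) simp
  then have "range ?row = ?row ` range coord"
    by simp
  also have "\<dots> = range (t 1)"
    by (simp only: image_image row_vec_self)
  finally show ?thesis .
qed

text \<open>
  Over the base field the points of \<open>Y\<^sub>0\<close> are the submodules of the theorem, by the count of dimensions
  in \<open>has_codim_iff_complement\<close>.
\<close>

lemma submodule_iff_Y0_point:
  "left_submodule (obar_act t) L \<and> has_codim (fbar_scale t) L CARD('n) \<and> transversal_V t L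
    \<longleftrightarrow> L \<in> Y0_points p t (\<lambda>x c. fbar_scale t c x)" (is "?lhs \<longleftrightarrow> ?rhs")
proof
  assume ?lhs
  then have L: "F.subspace L" "obar_act t obar_theta ` L \<subseteq> L" "L \<inter> range (t 1) = {0}"
    "\<And>x. \<exists>y\<in>L. \<exists>v\<in>range (t 1). x = y + v"
    using has_codim_iff_complement[of L] unfolding left_submodule_iff transversal_V_def by auto
  then have "locally_free_quotient (fbar_scale t) L CARD('n)"
    using self.complement_locally_free[of L] unfolding bc_scale_self range_row_vec_self by auto
  with L show ?rhs
    unfolding Y0_points_def Y_points_def grass_points_def self.bc_V_eq range_row_vec_self bc_scale_self
    by (auto simp: bc_theta_self)
next
  assume ?rhs
  then have "F.subspace L" "obar_act t obar_theta ` L \<subseteq> L" "L \<inter> range (t 1) = {0}"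
    "\<forall>x. \<exists>y\<in>L. \<exists>v\<in>range (t 1). x = y + v"
    unfolding Y0_points_def Y_points_def grass_points_def self.bc_V_eq range_row_vec_self bc_scale_self
    by (auto simp: bc_theta_self)
  then show ?lhs
    using has_codim_iff_complement[of L] by (simp add: left_submodule_iff transversal_V_def)
qed

lemma L_of_eq_L_points:
  assumes "p_linear p scaleV \<phi>" "has_matrix scaleV e \<phi> B"
  shows "L_points p t (\<lambda>x c. fbar_scale t c x) e B = L_of t \<phi>"
proof -
  let ?th = "bc_theta p t (\<lambda>x c. fbar_scale t c x)" and ?row = "row_vec t (\<lambda>x c. fbar_scale t c x) e"
  have th_power: "(?th ^^ a) (t 1 v) = t (obar_theta ^ a) v" for a v
    by (induction a) (simp_all add: bc_theta_self)
  have gen: "t (obar_theta ^ (a + b)) ((\<phi> ^^ c) v) - t (obar_theta ^ a) ((\<phi> ^^ (b + c)) v)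
      = (?th ^^ (a + b)) (?row ((row_map p B ^^ c) (coord v)))
        - (?th ^^ a) (?row ((row_map p B ^^ (b + c)) (coord v)))" for a b c v
    by (simp only: row_vec_self th_power flip: coord_p_linear_power[OF assms])
  \<comment> \<open>Every row is the coordinate row of a vector, so both families of generators have the same index set.\<close>
  have ex_coord: "(\<exists>m. P m) \<longleftrightarrow> (\<exists>v. P (coord v))" for P
    by (metis coord_sum)
  have "{(?th ^^ (a + b)) (?row ((row_map p B ^^ c) m)) - (?th ^^ a) (?row ((row_map p B ^^ (b + c)) m)) | m a b c. True}
      = {t (obar_theta ^ (a + b)) ((\<phi> ^^ c) v) - t (obar_theta ^ a) ((\<phi> ^^ (b + c)) v) | v a b c. True}"
    unfolding gen by (rule Collect_cong) (rule ex_coord)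
  then show ?thesis
    by (simp only: L_points_def L_of_def bc_scale_self)
qed

end


section \<open>The correspondence theorem\<close>

theorem theorem6p1:
  fixes p n :: nat
    and scaleV :: "'k::{alg_closed_field,field_prime_char} \<Rightarrow> 'v::ab_group_add \<Rightarrow> 'v"
    and t :: "('k, 'n::finite) ore_bar \<Rightarrow> 'v \<Rightarrow> 'f::ab_group_add"
  assumes k: "is_alg_closure_Fp p TYPE('k)"
    and n: "n = CARD('n)"
    and V: "vector_space scaleV" "vector_space.dim scaleV UNIV = n"
    and F: "tensor_product obar_ract scaleV t"
  shows "(\<forall>\<phi>. p_nilpotent p scaleV \<phi> \<longrightarrow>
            left_submodule (obar_act t) (L_of t \<phi>) \<and>
            has_codim (fbar_scale t) (L_of t \<phi>) n \<and>
            transversal_V t (L_of t \<phi>))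
       \<and> bij_betw (L_of t) {\<phi>. p_nilpotent p scaleV \<phi>}
            {L. left_submodule (obar_act t) L \<and> has_codim (fbar_scale t) L n \<and> transversal_V t L}
       \<and> (\<forall>e :: 'n \<Rightarrow> 'v. is_basis scaleV e \<longrightarrow>
            (\<forall>\<phi> B. p_linear p scaleV \<phi> \<and> has_matrix scaleV e \<phi> B \<longrightarrow>
               (p_nilpotent p scaleV \<phi> \<longleftrightarrow> B \<in> nilp_points p) \<and>
               (p_nilpotent p scaleV \<phi> \<longrightarrow>
                  L_points p t (\<lambda>x c. fbar_scale t c x) e B = L_of t \<phi>))
          \<and> (\<forall>(\<eta> :: 'k \<Rightarrow> 'r::comm_ring_1) (tR :: 'f \<Rightarrow> 'r \<Rightarrow> 'fr::ab_group_add).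
               base_change t \<eta> tR \<longrightarrow>
                 bij_betw (L_points p t tR e) (nilp_points p) (Y0_points p t tR)
               \<and> (\<forall>(\<eta>' :: 'k \<Rightarrow> 's::comm_ring_1) (tS :: 'f \<Rightarrow> 's \<Rightarrow> 'fs::ab_group_add) (f :: 'r \<Rightarrow> 's).
                    base_change t \<eta>' tS \<and> is_ring_hom f \<and> f \<circ> \<eta> = \<eta>' \<longrightarrow>
                    (\<forall>B\<in>nilp_points p. map_matrix f B \<in> nilp_points p \<and>
                       L_points p t tS e (map_matrix f B) = pullback_sub tR tS f (L_points p t tR e B)))
               \<and> (\<forall>A :: 'k^'n^'n. invertible A \<longrightarrow>
                    (\<forall>B\<in>nilp_points p. gl_act_mat p \<eta> A B \<in> nilp_points p \<and>
                       L_points p t tR e (gl_act_mat p \<eta> A B) =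
                         gl_act_sub t scaleV e tR A (L_points p t tR e B)))))"
proof -
  interpret V: vector_space scaleV by (rule V)
  have p: "p = CHAR('k)"
    using k by (simp add: is_alg_closure_Fp_def)
  have fbar: "fbar scaleV t p e" if "is_basis scaleV e" for e :: "'n \<Rightarrow> 'v"
    by (intro fbar.intro V(1) tensor.intro F fbar_axioms.intro p that)
  obtain e where e: "is_basis scaleV (e :: 'n \<Rightarrow> 'v)"
  proof -
    obtain b where b: "V.independent b" "UNIV \<subseteq> V.span b" "card b = n"
      using V.basis_exists[of UNIV] V(2) by metis
    then have "finite b"
      using n by (intro card_ge_0_finite) simp
    then obtain e :: "'n \<Rightarrow> 'v" where "bij_betw e UNIV b"
      using b(3) n finite_same_card_bij[of "UNIV :: 'n set" b] by auto
    with b have "is_basis scaleV e"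
      by (auto simp: is_basis_def bij_betw_def)
    then show ?thesis by (rule that)
  qed
  interpret fbar scaleV t p e by (rule fbar[OF e])
  \<comment> \<open>Any basis serves for the part that does not mention one; over \<open>k\<close> it translates
    \<open>L_of\<close> into \<open>L_points\<close> for \<open>R = k\<close>.\<close>
  let ?Y = "{L. left_submodule (obar_act t) L \<and> has_codim (fbar_scale t) L n \<and> transversal_V t L}"
  have Y: "?Y = Y0_points p t (\<lambda>x c. fbar_scale t c x)"
    using submodule_iff_Y0_point by (simp only: n Collect_mem_eq)
  have matrix: "\<exists>B\<in>nilp_points p. has_matrix scaleV e \<phi> B \<and> L_of t \<phi> = L_points p t (\<lambda>x c. fbar_scale t c x) e B"
    if "p_nilpotent p scaleV \<phi>" for \<phi>
    using that p_linear_has_matrix p_nilpotent_iff_nilp_point L_of_eq_L_points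
    unfolding p_nilpotent_def by metis
  note bij = self.bij_betw_L_points
  have bij_L_of: "bij_betw (L_of t) {\<phi>. p_nilpotent p scaleV \<phi>} ?Y"
    unfolding Y bij_betw_def
  proof
    show "inj_on (L_of t) {\<phi>. p_nilpotent p scaleV \<phi>}"
    proof (rule inj_onI, unfold mem_Collect_eq)
      fix \<phi> \<psi>
      assume \<phi>: "p_nilpotent p scaleV \<phi>" and \<psi>: "p_nilpotent p scaleV \<psi>" and eq: "L_of t \<phi> = L_of t \<psi>"
      obtain B C where B: "B \<in> nilp_points p" "has_matrix scaleV e \<phi> B"
          "L_of t \<phi> = L_points p t (\<lambda>x c. fbar_scale t c x) e B"
        and C: "C \<in> nilp_points p" "has_matrix scaleV e \<psi> C"
          "L_of t \<psi> = L_points p t (\<lambda>x c. fbar_scale t c x) e C"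
        using matrix[OF \<phi>] matrix[OF \<psi>] by blast
      have "B = C"
        using bij_betw_imp_inj_on[OF bij] B C eq by (metis inj_onD)
      with B C \<phi> \<psi> show "\<phi> = \<psi>"
        unfolding p_nilpotent_def by (blast intro: p_linear_eqI)
    qed
    show "L_of t ` {\<phi>. p_nilpotent p scaleV \<phi>} = Y0_points p t (\<lambda>x c. fbar_scale t c x)"
    proof (intro equalityI subsetI)
      fix L assume "L \<in> L_of t ` {\<phi>. p_nilpotent p scaleV \<phi>}"
      then obtain \<phi> where "p_nilpotent p scaleV \<phi>" "L = L_of t \<phi>" by blast
      with matrix show "L \<in> Y0_points p t (\<lambda>x c. fbar_scale t c x)"
        using bij_betwE[OF bij] by metis
    next
      fix L assume "L \<in> Y0_points p t (\<lambda>x c. fbar_scale t c x)"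
      then obtain B where B: "B \<in> nilp_points p" "L = L_points p t (\<lambda>x c. fbar_scale t c x) e B"
        using bij by (auto simp only: bij_betw_def)
      obtain \<phi> where \<phi>: "p_linear p scaleV \<phi>" "has_matrix scaleV e \<phi> B"
        by (rule ex_p_linear_of_matrix)
      then show "L \<in> L_of t ` {\<phi>. p_nilpotent p scaleV \<phi>}"
        using B p_nilpotent_iff_nilp_point[OF \<phi>] L_of_eq_L_points[OF \<phi>] by blast
    qed
  qed
  show ?thesis
  proof (rule conjI, goal_cases)
    case 1
    show ?case using bij_betwE[OF bij_L_of] by blast
  next
    case 2
    show ?case
    proof (intro conjI allI impI)
      show "bij_betw (L_of t) {\<phi>. p_nilpotent p scaleV \<phi>} ?Y" by (rule bij_L_of)
    next
      fix e :: "'n \<Rightarrow> 'v" and \<phi> B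
      assume e: "is_basis scaleV e" and \<phi>: "p_linear p scaleV \<phi> \<and> has_matrix scaleV e \<phi> B"
      interpret e: fbar scaleV t p e by (rule fbar[OF e])
      show "p_nilpotent p scaleV \<phi> \<longleftrightarrow> B \<in> nilp_points p"
        using e.p_nilpotent_iff_nilp_point \<phi> by blast
      show "L_points p t (\<lambda>x c. fbar_scale t c x) e B = L_of t \<phi>"
        using e.L_of_eq_L_points \<phi> by blast
    next
      fix e :: "'n \<Rightarrow> 'v" and \<eta> :: "'k \<Rightarrow> 'r" and tR :: "'f \<Rightarrow> 'r \<Rightarrow> 'fr"
      assume e: "is_basis scaleV e" and R: "base_change t \<eta> tR"
      interpret e: fbar scaleV t p e by (rule fbar[OF e])
      interpret R: fbar_base_change scaleV t p e \<eta> tR by standard (rule R)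
      show "bij_betw (L_points p t tR e) (nilp_points p) (Y0_points p t tR)"
        by (rule R.bij_betw_L_points)
      show "\<forall>B\<in>nilp_points p. map_matrix f B \<in> nilp_points p \<and>
          L_points p t tS e (map_matrix f B) = pullback_sub tR tS f (L_points p t tR e B)"
        if "base_change t \<eta>' tS \<and> is_ring_hom f \<and> f \<circ> \<eta> = \<eta>'"
        for \<eta>' :: "'k \<Rightarrow> 's" and tS :: "'f \<Rightarrow> 's \<Rightarrow> 'fs" and f
        using that e.pullback_L_points[OF R] by blast
      show "\<forall>B\<in>nilp_points p. gl_act_mat p \<eta> A B \<in> nilp_points p \<and>
          L_points p t tR e (gl_act_mat p \<eta> A B) = gl_act_sub t scaleV e tR A (L_points p t tR e B)"
        if "invertible A" for A :: "'k^'n^'n"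
        using that R.L_points_equivariant by blast
    qed
  qed
qed

end
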